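(* Let $2\le k<n$ and let $\Lambda$ be a nonempty set of number partitions of $n$ with $(1^n),(n)\notin\Lambda$ satisfying the following condition: if $\mu=(\mu_1,\dots,\mu_t)\in\Lambda$, where $\mu_i=kq_i+r_i$ with $0\le r_i<k$ for $i\in[t]$, then $(k^{q_1+\dots+q_t},1^{r_1+\dots+r_t})\in\Lambda$. Let $\mathbf{k}$ be a field with $\mathrm{char}\,\mathbf{k}=0$ or $\mathrm{char}\,\mathbf{k}>n$. Then the multiplicity of the trivial character in the representation $\mathcal{S}_n\to GL(\widetilde H_i(\Delta(\Pi_\Lambda),\mathbf{k}))$ is $0$ for all $i$.
   Context: The type of a set partition is the number partition formed by its block sizes. $\Pi_\Lambda$ is the poset, ordered by refinement, of all set partitions of $[n]=\{1,\dots,n\}$ whose type belongs to $\Lambda$. $\Delta(\Pi_\Lambda)$ is its order complex (simplices are finite chains), and $\mathcal{S}_n$ acts on it, hence on its homology, via the permutation action on $[n]$. The power notation $(k^a,1^b)$ means $a$ parts equal to $k$ and $b$ parts equal to $1$. *)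

theory Defs
  imports
    "HOL-Algebra.Algebraic_Closure_Type"
    "HOL-Algebra.Module"
    "HOL-Algebra.AbelCoset"
    "HOL-Algebra.Sym_Groups"
    "HOL-Library.Disjoint_Sets"
    "HOL-Library.Multiset"
    "HOL-Library.FuncSet"
begin

section \<open>Set partitions with restricted type\<close>

definition number_partitions :: "nat \<Rightarrow> nat multiset set" where
  "number_partitions n = {\<mu>. 0 \<notin># \<mu> \<and> \<Sum>\<^sub># \<mu> = n}"

definition partition_type :: "nat set set \<Rightarrow> nat multiset" where
  "partition_type P = image_mset card (mset_set P)"

text \<open>The underlying set of the poset; its order is \<^term>\<open>refines {1..n}\<close>.\<close>

definition Pi_poset :: "nat \<Rightarrow> nat multiset set \<Rightarrow> nat set set set" where
  "Pi_poset n \<Lambda> = {P. partition_on {1..n} P \<and> partition_type P \<in> \<Lambda>}"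


section \<open>Order complexes and their reduced simplicial homology\<close>

definition order_complex :: "'p set \<Rightarrow> ('p \<Rightarrow> 'p \<Rightarrow> bool) \<Rightarrow> 'p set set" where
  "order_complex P leq = {\<sigma>. finite \<sigma> \<and> \<sigma> \<subseteq> P \<and> (\<forall>x\<in>\<sigma>. \<forall>y\<in>\<sigma>. leq x y \<or> leq y x)}"

text \<open>
  Chains with coefficients in a field are finitely supported functions on simplices.  Every
  simplex is oriented by the order of its vertices.  The empty simplex is included and has
  dimension \<open>-1\<close>, so that the complex is the augmented one and its homology is reduced; in
  degrees below \<open>-1\<close> there are no simplices.
\<close>

definition chain_space :: "'p set \<Rightarrow> ('p \<Rightarrow> 'p \<Rightarrow> bool) \<Rightarrow> int \<Rightarrow> ('p set \<Rightarrow> 'a::field) set" where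
  "chain_space P leq i =
     {c. finite {\<sigma>. c \<sigma> \<noteq> 0} \<and>
         (\<forall>\<sigma>. c \<sigma> \<noteq> 0 \<longrightarrow> \<sigma> \<in> order_complex P leq \<and> int (card \<sigma>) = i + 1)}"

text \<open>
  Linear extension of
  \<open>{x\<^sub>0 < \<dots> < x\<^sub>d} \<mapsto> \<Sum>j. (-1)^j {x\<^sub>0 < \<dots> < x\<^sub>d} - {x\<^sub>j}\<close>:
  the position \<open>j\<close> of a vertex is the number of vertices below it.
\<close>

definition boundary :: "('p \<Rightarrow> 'p \<Rightarrow> bool) \<Rightarrow> ('p set \<Rightarrow> 'a::field) \<Rightarrow> 'p set \<Rightarrow> 'a" where
  "boundary leq c =
     (\<lambda>\<tau>. \<Sum>\<sigma> | c \<sigma> \<noteq> 0.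
        c \<sigma> * (\<Sum>x | x \<in> \<sigma> \<and> \<sigma> - {x} = \<tau>. (-1) ^ card {y \<in> \<sigma>. y \<noteq> x \<and> leq y x}))"

definition cycles :: "'p set \<Rightarrow> ('p \<Rightarrow> 'p \<Rightarrow> bool) \<Rightarrow> int \<Rightarrow> ('p set \<Rightarrow> 'a::field) set" where
  "cycles P leq i = {c \<in> chain_space P leq i. boundary leq c = (\<lambda>_. 0)}"

definition boundaries :: "'p set \<Rightarrow> ('p \<Rightarrow> 'p \<Rightarrow> bool) \<Rightarrow> int \<Rightarrow> ('p set \<Rightarrow> 'a::field) set" where
  "boundaries P leq i = boundary leq ` chain_space P leq (i + 1)"

text \<open>
  In the module records below the multiplicative ring fields \<open>mult\<close> and \<open>one\<close> carry no
  information.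
\<close>

definition cycle_module ::
    "'p set \<Rightarrow> ('p \<Rightarrow> 'p \<Rightarrow> bool) \<Rightarrow> int \<Rightarrow> ('a::field, 'p set \<Rightarrow> 'a) module" where
  "cycle_module P leq i =
     \<lparr>carrier = cycles P leq i, monoid.mult = undefined, one = undefined,
      zero = (\<lambda>_. 0), add = (\<lambda>c d \<sigma>. c \<sigma> + d \<sigma>), module.smult = (\<lambda>a c \<sigma>. a * c \<sigma>)\<rparr>"

definition quotient_module :: "('a, 'b) module \<Rightarrow> 'b set \<Rightarrow> ('a, 'b set) module" where
  "quotient_module M N =
     \<lparr>carrier = a_rcosets\<^bsub>M\<^esub> N, monoid.mult = undefined, one = undefined,
      zero = N, add = (\<lambda>A B. A <+>\<^bsub>M\<^esub> B), module.smult = (\<lambda>a A. \<Union>x\<in>A. N +>\<^bsub>M\<^esub> (a \<odot>\<^bsub>M\<^esub> x))\<rparr>"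

definition reduced_homology ::
    "'p set \<Rightarrow> ('p \<Rightarrow> 'p \<Rightarrow> bool) \<Rightarrow> int \<Rightarrow> ('a::field, ('p set \<Rightarrow> 'a) set) module" where
  "reduced_homology P leq i = quotient_module (cycle_module P leq i) (boundaries P leq i)"

text \<open>
  Linear extension of \<open>\<sigma> \<mapsto> f ` \<sigma>\<close>.  For an automorphism \<open>f\<close> of the poset no signs
  occur, since \<open>f\<close> preserves the orientations chosen above.  The induced map on homology sends
  a coset to its image.
\<close>

definition chain_map :: "('p \<Rightarrow> 'p) \<Rightarrow> ('p set \<Rightarrow> 'a::field) \<Rightarrow> 'p set \<Rightarrow> 'a" where
  "chain_map f c = (\<lambda>\<tau>. \<Sum>\<sigma> | c \<sigma> \<noteq> 0 \<and> f ` \<sigma> = \<tau>. c \<sigma>)"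

definition permute_partition :: "(nat \<Rightarrow> nat) \<Rightarrow> nat set set \<Rightarrow> nat set set" where
  "permute_partition g P = (\<lambda>B. g ` B) ` P"

definition homology_action ::
    "(nat \<Rightarrow> nat) \<Rightarrow> (nat set set set \<Rightarrow> 'a::field) set \<Rightarrow> (nat set set set \<Rightarrow> 'a) set" where
  "homology_action g A = chain_map (permute_partition g) ` A"


section \<open>Multiplicity of the trivial representation\<close>

text \<open>
  Below, \<open>V\<close> is a vector space over \<open>K\<close> and \<open>\<rho>\<close> a representation of \<open>G\<close> on \<open>V\<close>.
\<close>

definition subrepresentation ::
    "('g, 'x) monoid_scheme \<Rightarrow> 'a ring \<Rightarrow> ('a, 'v) module \<Rightarrow> ('g \<Rightarrow> 'v \<Rightarrow> 'v) \<Rightarrow> 'v set \<Rightarrow> bool"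
  where
  "subrepresentation G K V \<rho> U \<longleftrightarrow>
     submodule U K V \<and> (\<forall>g \<in> carrier G. \<forall>u \<in> U. \<rho> g u \<in> U)"

definition irreducible_subrepresentation ::
    "('g, 'x) monoid_scheme \<Rightarrow> 'a ring \<Rightarrow> ('a, 'v) module \<Rightarrow> ('g \<Rightarrow> 'v \<Rightarrow> 'v) \<Rightarrow> 'v set \<Rightarrow> bool"
  where
  "irreducible_subrepresentation G K V \<rho> U \<longleftrightarrow>
     subrepresentation G K V \<rho> U \<and> U \<noteq> {\<zero>\<^bsub>V\<^esub>} \<and>
     (\<forall>W. subrepresentation G K V \<rho> W \<longrightarrow> W \<subseteq> U \<longrightarrow> W = {\<zero>\<^bsub>V\<^esub>} \<or> W = U)"

definition trivial_subrepresentation ::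
    "('g, 'x) monoid_scheme \<Rightarrow> 'a ring \<Rightarrow> ('a, 'v) module \<Rightarrow> ('g \<Rightarrow> 'v \<Rightarrow> 'v) \<Rightarrow> 'v set \<Rightarrow> bool"
  where
  "trivial_subrepresentation G K V \<rho> U \<longleftrightarrow>
     (\<exists>v \<in> carrier V. v \<noteq> \<zero>\<^bsub>V\<^esub> \<and> U = {a \<odot>\<^bsub>V\<^esub> v | a. a \<in> carrier K}) \<and>
     (\<forall>g \<in> carrier G. \<forall>u \<in> U. \<rho> g u = u)"

definition irreducible_decomposition ::
    "('g, 'x) monoid_scheme \<Rightarrow> 'a ring \<Rightarrow> ('a, 'v) module \<Rightarrow> ('g \<Rightarrow> 'v \<Rightarrow> 'v) \<Rightarrow>
      nat \<Rightarrow> (nat \<Rightarrow> 'v set) \<Rightarrow> bool"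
  where
  "irreducible_decomposition G K V \<rho> m U \<longleftrightarrow>
     (\<forall>j<m. irreducible_subrepresentation G K V \<rho> (U j)) \<and>
     (\<forall>v \<in> carrier V. \<exists>!u. u \<in> (\<Pi>\<^sub>E j\<in>{..<m}. U j) \<and> v = (\<Oplus>\<^bsub>V\<^esub>j\<in>{..<m}. u j))"

text \<open>
  The number of trivial summands in a decomposition into irreducibles.  The description is
  proper only if such a decomposition exists and all of them give the same number (true for
  finite-dimensional \<open>V\<close> when the characteristic does not divide the order of \<open>G\<close>); an
  improper \<open>THE\<close> has no provable value, in particular not \<open>0\<close>.
\<close>

definition trivial_multiplicity ::
    "('g, 'x) monoid_scheme \<Rightarrow> 'a ring \<Rightarrow> ('a, 'v) module \<Rightarrow> ('g \<Rightarrow> 'v \<Rightarrow> 'v) \<Rightarrow> nat"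
  where
  "trivial_multiplicity G K V \<rho> =
     (THE t. \<exists>m U. irreducible_decomposition G K V \<rho> m U \<and>
                   t = card {j. j < m \<and> trivial_subrepresentation G K V \<rho> (U j)})"

end

theory Submission
  imports Defs "HOL-Library.Function_Algebras"
begin

text \<open>
  By Maschke's theorem the homology is a direct sum of irreducibles, and by averaging over the
  group it suffices that every invariant cycle \<open>z\<close> is a boundary.

  Let \<open>K\<close> be the set of partitions in \<open>\<Pi>\<^sub>\<Lambda>\<close> all of whose blocks have size \<open>1\<close> or \<open>k\<close>. A chain \<open>\<sigma>\<close> is
  matched by inserting or removing an element \<open>q\<close> of \<open>K\<close> below all of \<open>\<sigma> - K\<close> having as many blocks of
  size \<open>k\<close> as possible. It exists by the closure property of \<open>\<Lambda>\<close>, applied to the least element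
  of \<open>\<sigma> - K\<close>, and it is unique up to the stabilizer of \<open>\<sigma>\<close>, which permutes the singletons that are
  still to be grouped. So the matching is well defined on orbits of chains, and it gives an operator
  \<open>h\<close> on invariant chains such that \<open>z - \<partial> (h z)\<close> is again an invariant cycle, but supported on
  chains with fewer elements outside of \<open>K\<close>. Iterating this ends at \<open>0\<close>.
\<close>

section \<open>Representations of finite groups\<close>

text \<open>The obstacle is that an equivariant choice of \<open>q\<close> need not exist, because
  the candidates for one chain are permuted among themselves. The operator therefore spreads the
  value of a chain evenly over all candidates and divides by their number. By orbit-stabilizer that
  number divides n!, so the condition on the characteristic makes it invertible. The same condition
  permits the averaging in Maschke's theorem and excludes characteristic 2, since 2 divides n!. The
  spreading is compatible with the boundary only in a weak sense: \<open>del (cone z) = z\<close> is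
  shown for invariant cycles, and only at chains with the largest number of elements outside
  \<open>K\<close> that the support allows. This is why the correction has to be iterated, with the
  number of elements outside \<open>K\<close> as measure. The closure condition enters through
  floors: a block of size k q + r holds at most q disjoint k-sets, and filling all blocks of a
  partition in this way produces exactly the type that the condition puts into \<Lambda>.\<close>

locale linear_action = vector_space scale + group G
  for scale :: "'a::field \<Rightarrow> 'v::ab_group_add \<Rightarrow> 'v" (infixr \<open>*s\<close> 75)
    and G :: "('g, 'x) monoid_scheme" (structure) +
  fixes \<rho> :: "'g \<Rightarrow> 'v \<Rightarrow> 'v"
  assumes finite_group: "finite (carrier G)"
    and card_group_nonzero: "of_nat (card (carrier G)) \<noteq> (0::'a)"
    and action_add: "g \<in> carrier G \<Longrightarrow> \<rho> g (v + w) = \<rho> g v + \<rho> g w"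
    and action_scale: "g \<in> carrier G \<Longrightarrow> \<rho> g (a *s v) = a *s \<rho> g v"
    and action_mult: "g \<in> carrier G \<Longrightarrow> h \<in> carrier G \<Longrightarrow> \<rho> (g \<otimes> h) v = \<rho> g (\<rho> h v)"
    and action_one: "\<rho> \<one> v = v"
begin

definition stable :: "'v set \<Rightarrow> bool" where
  "stable W \<longleftrightarrow> subspace W \<and> (\<forall>g\<in>carrier G. \<forall>w\<in>W. \<rho> g w \<in> W)"

definition simple :: "'v set \<Rightarrow> bool" where
  "simple W \<longleftrightarrow> stable W \<and> W \<noteq> {0} \<and> (\<forall>W'. stable W' \<longrightarrow> W' \<subseteq> W \<longrightarrow> W' = {0} \<or> W' = W)"

lemma stable_subspace: "stable W \<Longrightarrow> subspace W"
  by (simp add: stable_def)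

lemma stable_action: "stable W \<Longrightarrow> g \<in> carrier G \<Longrightarrow> w \<in> W \<Longrightarrow> \<rho> g w \<in> W"
  by (simp add: stable_def)

lemma action_zero: "g \<in> carrier G \<Longrightarrow> \<rho> g 0 = 0"
  using action_scale[of g 0 0] by simp

lemma action_diff: "g \<in> carrier G \<Longrightarrow> \<rho> g (v - w) = \<rho> g v - \<rho> g w"
  using action_add[of g "v - w" w] by simp

lemma action_sum: "g \<in> carrier G \<Longrightarrow> \<rho> g (sum f A) = (\<Sum>x\<in>A. \<rho> g (f x))"
  by (induction A rule: infinite_finite_induct) (simp_all add: action_zero action_add)

lemma action_inv_cancel: "g \<in> carrier G \<Longrightarrow> \<rho> g (\<rho> (inv g) v) = v"
  using action_mult[of g "inv g" v] by (simp add: action_one)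

lemma bij_betw_mult_left:
  assumes "g \<in> carrier G"
  shows "bij_betw (\<lambda>h. g \<otimes> h) (carrier G) (carrier G)"
  by (simp add: bij_betw_def assms inj_on_cmult surj_const_mult)

lemma stable_sum:
  assumes "stable Y" "stable W"
  shows "stable {y + w |y w. y \<in> Y \<and> w \<in> W}"
  using assms unfolding stable_def
  by (auto simp: action_add intro!: subspace_sums) blast

lemma sum_const_scale: "finite A \<Longrightarrow> (\<Sum>x\<in>A. v) = of_nat (card A) *s v"
  by (induction A rule: finite_induct) (simp_all add: scale_left_distrib)

lemma invariant_orbit_sum:
  assumes "g \<in> carrier G"
  shows "\<rho> g (\<Sum>h\<in>carrier G. \<rho> h v) = (\<Sum>h\<in>carrier G. \<rho> h v)"
proof -
  have "\<rho> g (\<Sum>h\<in>carrier G. \<rho> h v) = (\<Sum>h\<in>carrier G. \<rho> (g \<otimes> h) v)"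
    by (simp add: action_sum action_mult assms)
  also have "\<dots> = (\<Sum>h\<in>carrier G. \<rho> h v)"
    by (rule sum.reindex_bij_betw[OF bij_betw_mult_left[OF assms]])
  finally show ?thesis .
qed

text \<open>Maschke's argument: \<open>q\<close> averages the conjugates of a linear projection
  \<open>p\<close> onto \<open>Y\<close>. It is again a projection onto \<open>Y\<close>, it
  commutes with the action, and its kernel in \<open>Z\<close> is the complement.\<close>

lemma stable_complement:
  assumes Y: "stable Y" and Z: "stable Z" and "Y \<subseteq> Z"
  obtains W where "stable W" "W \<subseteq> Z" "Y \<inter> W = {0}" "\<And>z. z \<in> Z \<Longrightarrow> \<exists>y\<in>Y. z - y \<in> W"
proof -
  interpret vs: vector_space_pair scale scale by unfold_locales
  \<comment> \<open>A left inverse of the inclusion of \<open>Y\<close> with range in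
    \<open>Y\<close> is a linear projection onto \<open>Y\<close>, not yet equivariant.\<close>
  have "\<exists>p. p ` UNIV \<subseteq> Y \<and> Vector_Spaces.linear scale scale p \<and> (\<forall>v\<in>Y. p (id v) = v)"
    by (rule vs.linear_exists_left_inverse_on)
      (use Y in \<open>auto simp: stable_def linear_id id_def linear_ident\<close>)
  then obtain p where pY: "\<And>v. p v \<in> Y" and p: "Vector_Spaces.linear scale scale p"
    and pid: "\<And>v. v \<in> Y \<Longrightarrow> p v = v" by auto
  interpret p: Vector_Spaces.linear scale scale p by fact
  define c :: 'a where "c = inverse (of_nat (card (carrier G)))"
  define q where "q v = c *s (\<Sum>g\<in>carrier G. \<rho> g (p (\<rho> (inv g) v)))" for v
  have q_add: "q (v + w) = q v + q w" for v w
    by (simp add: q_def action_add p.add sum.distrib scale_right_distrib)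
  have q_scale: "q (a *s v) = a *s q v" for a v
    by (simp add: q_def action_scale p.scale scale_sum_right mult.commute)
  have q_zero: "q 0 = 0" using q_scale[of 0 0] by simp
  have qY: "q v \<in> Y" for v
    unfolding q_def using Y pY
    by (auto intro!: subspace_scale subspace_sum simp: stable_def)
  have qid: "q v = v" if "v \<in> Y" for v
  proof -
    have "(\<Sum>g\<in>carrier G. \<rho> g (p (\<rho> (inv g) v))) = (\<Sum>g\<in>carrier G. v)"
      by (rule sum.cong) (use Y that in \<open>auto simp: pid stable_action action_inv_cancel\<close>)
    then show ?thesis
      by (simp add: q_def sum_const_scale finite_group c_def card_group_nonzero)
  qed
  have q_comm: "q (\<rho> g v) = \<rho> g (q v)" if g: "g \<in> carrier G" for g v
  proof -
    \<comment> \<open>The factor \<open>g\<close> is absorbed into the summation index, because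
      \<open>\<rho> (inv (g \<otimes> h)) (\<rho> g v)\<close> equals
      \<open>\<rho> (inv h) v\<close>.\<close>
    have "\<rho> g (\<Sum>h\<in>carrier G. \<rho> h (p (\<rho> (inv h) v)))
        = (\<Sum>h\<in>carrier G. \<rho> (g \<otimes> h) (p (\<rho> (inv (g \<otimes> h)) (\<rho> g v))))"
      by (auto simp: action_sum g action_mult inv_mult_group intro!: sum.cong)
        (metis action_mult action_one g inv_closed l_inv)
    also have "\<dots> = (\<Sum>h\<in>carrier G. \<rho> h (p (\<rho> (inv h) (\<rho> g v))))"
      by (rule sum.reindex_bij_betw[OF bij_betw_mult_left[OF g]])
    finally show ?thesis
      by (simp add: q_def action_scale g)
  qed
  define W where "W = {z \<in> Z. q z = 0}"
  show thesis
  proof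
    show "stable W"
      using Z unfolding stable_def W_def
      by (auto simp: subspace_def q_add q_scale q_zero q_comm action_zero)
    show "W \<subseteq> Z" by (auto simp: W_def)
    show "Y \<inter> W = {0}"
      using Y Z by (auto simp: W_def qid q_zero stable_def subspace_0)
    show "\<exists>y\<in>Y. z - y \<in> W" if "z \<in> Z" for z
    proof
      have "q z \<in> Z" using qY \<open>Y \<subseteq> Z\<close> by blast
      moreover have "q (z - q z) = 0"
        using q_add[of "z - q z" "q z"] qid[OF qY] by simp
      ultimately show "z - q z \<in> W"
        using that Z by (auto simp: W_def stable_def subspace_diff)
    qed (rule qY)
  qed
qed

section \<open>Decomposition into simple subspaces\<close>

text \<open>The ambient space may be infinite-dimensional, where \<open>dim\<close> is not monotone.
  The finite set \<open>D\<close> bounds all independent subsets of \<open>Z\<close>, so a basis of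
  \<open>Y\<close> extends to a strictly larger finite basis of \<open>Z\<close>.\<close>

lemma dim_less:
  assumes "subspace Y" "Y \<subset> Z" "Z \<subseteq> span D" "finite D"
  shows "dim Y < dim Z"
proof -
  obtain B where B: "B \<subseteq> Y" "independent B" "Y \<subseteq> span B" "card B = dim Y"
    using basis_exists by blast
  obtain C where C: "B \<subseteq> C" "C \<subseteq> Z" "independent C" "Z \<subseteq> span C"
    using maximal_independent_subset_extend[of B Z] B assms(2) by blast
  have "finite C"
    using independent_span_bound[OF \<open>finite D\<close> C(3)] C(2) assms(3) by auto
  have "B \<noteq> C"
    using assms(1,2) B C span_minimal[OF B(1) assms(1)] by blast
  then have "card B < card C"
    using C(1) \<open>finite C\<close> by (simp add: psubset_card_mono psubsetI)
  moreover have "card C = dim Z"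
    using basis_card_eq_dim C by blast
  ultimately show ?thesis using B(4) by simp
qed

lemma simple_subset_exists:
  assumes "stable W" "W \<noteq> {0}" "W \<subseteq> span D" "finite D"
  shows "\<exists>S\<subseteq>W. simple S"
  using assms
proof (induction "dim W" arbitrary: W rule: less_induct)
  case less
  show ?case
  proof (cases "simple W")
    case False
    then obtain W' where "stable W'" "W' \<subset> W" "W' \<noteq> {0}"
      using less.prems unfolding simple_def by blast
    moreover then have "dim W' < dim W"
      using dim_less stable_subspace less.prems by blast
    ultimately show ?thesis
      using less.hyps[of W'] less.prems by blast
  qed blast
qed

text \<open>Relative form of complete reducibility: the \<open>U j\<close> are independent modulo
  \<open>Y\<close> and span \<open>Z\<close> together with \<open>Y\<close>. With boundaries as
  \<open>Y\<close> this decomposes homology while all linear algebra stays on chains. The induction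
  is on the codimension of \<open>Y\<close>; each step enlarges \<open>Y\<close> by a simple
  subspace of a complement.\<close>

lemma simple_decomposition_over:
  assumes "stable Y" "stable Z" "Y \<subseteq> Z" "Z \<subseteq> span D" "finite D"
  shows "\<exists>(m::nat) U. (\<forall>j<m. simple (U j) \<and> U j \<subseteq> Z)
    \<and> (\<forall>z\<in>Z. \<exists>u. (\<forall>j<m. u j \<in> U j) \<and> z - (\<Sum>j<m. u j) \<in> Y)
    \<and> (\<forall>u. (\<forall>j<m. u j \<in> U j) \<longrightarrow> (\<Sum>j<m. u j) \<in> Y \<longrightarrow> (\<forall>j<m. u j = 0))"
  using assms
proof (induction "dim Z - dim Y" arbitrary: Y rule: less_induct)
  case less
  show ?case
  proof (cases "Y = Z")
    case True
    then show ?thesis by (intro exI[of _ 0]) auto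
  next
    case False
    obtain C where C: "stable C" "C \<subseteq> Z" "Y \<inter> C = {0}" "\<And>z. z \<in> Z \<Longrightarrow> \<exists>y\<in>Y. z - y \<in> C"
      using stable_complement[OF less.prems(1-3)] by metis
    have "C \<noteq> {0}"
    proof
      assume "C = {0}"
      then have "Z \<subseteq> Y" using C(4) by auto
      with False less.prems(3) show False by blast
    qed
    then obtain S where S: "S \<subseteq> C" "simple S"
      using simple_subset_exists[of C D] C less.prems by blast
    have sS: "stable S" using S simple_def by blast
    have YS: "Y \<inter> S = {0}"
      using S C sS less.prems(1) by (auto simp: stable_def subspace_0)
    define Y1 where "Y1 = {y + w |y w. y \<in> Y \<and> w \<in> S}"
    have Y1: "stable Y1"
      unfolding Y1_def by (rule stable_sum[OF less.prems(1) sS])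
    have "Y1 \<subseteq> Z"
      unfolding Y1_def using less.prems(2,3) S C(2)
      by (auto simp: stable_def intro!: subspace_add)
    have "Y \<subseteq> Y1"
      unfolding Y1_def using stable_subspace[OF sS] subspace_0 by force
    obtain s where "s \<in> S" "s \<noteq> 0"
      using S(2) subspace_0[OF stable_subspace[OF sS]] unfolding simple_def by blast
    then have "s \<notin> Y" using YS by blast
    moreover have "0 + s \<in> Y1"
      unfolding Y1_def using \<open>s \<in> S\<close> subspace_0[OF stable_subspace[OF less.prems(1)]] by blast
    ultimately have "s \<in> Y1" "s \<notin> Y" by simp_all
    then have "Y \<subset> Y1" using \<open>Y \<subseteq> Y1\<close> by blast
    then have "dim Y < dim Y1"
      using dim_less[of Y Y1 D] less.prems \<open>Y1 \<subseteq> Z\<close> by (auto simp: stable_def)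
    moreover have "dim Y < dim Z"
      using dim_less[of Y Z D] less.prems False by (auto simp: stable_def)
    ultimately have "dim Z - dim Y1 < dim Z - dim Y" by simp
    from less.hyps[OF this Y1 less.prems(2) \<open>Y1 \<subseteq> Z\<close> less.prems(4,5)]
    obtain m :: nat and U where U: "\<forall>j<m. simple (U j) \<and> U j \<subseteq> Z"
      and gen: "\<forall>z\<in>Z. \<exists>u. (\<forall>j<m. u j \<in> U j) \<and> z - (\<Sum>j<m. u j) \<in> Y1"
      and ind: "\<forall>u. (\<forall>j<m. u j \<in> U j) \<longrightarrow> (\<Sum>j<m. u j) \<in> Y1 \<longrightarrow> (\<forall>j<m. u j = 0)"
      by blast
    show ?thesis
    proof (intro exI[of _ "Suc m"] exI[of _ "U(m := S)"] conjI ballI allI impI)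
      fix j assume "j < Suc m"
      then show "simple ((U(m := S)) j)" "(U(m := S)) j \<subseteq> Z"
        using U S C(2) by (auto simp: less_Suc_eq)
    next
      fix z assume "z \<in> Z"
      then obtain u where u: "\<forall>j<m. u j \<in> U j" "z - (\<Sum>j<m. u j) \<in> Y1"
        using gen by blast
      then obtain y w where yw: "z - (\<Sum>j<m. u j) = y + w" "y \<in> Y" "w \<in> S"
        unfolding Y1_def by blast
      have "(\<Sum>j<Suc m. (u(m := w)) j) = (\<Sum>j<m. u j) + w"
        by simp
      then have "z - (\<Sum>j<Suc m. (u(m := w)) j) = y"
        using yw(1) by (simp add: algebra_simps)
      then show "\<exists>u. (\<forall>j<Suc m. u j \<in> (U(m := S)) j) \<and> z - (\<Sum>j<Suc m. u j) \<in> Y"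
        using u(1) yw by (intro exI[of _ "u(m := w)"]) (auto simp: less_Suc_eq)
    next
      fix u j assume u: "\<forall>j<Suc m. u j \<in> (U(m := S)) j" "(\<Sum>j<Suc m. u j) \<in> Y" "j < Suc m"
      have um: "u m \<in> S" and uj: "\<forall>j<m. u j \<in> U j"
        using u(1) by (auto simp: less_Suc_eq split: if_splits)
      \<comment> \<open>Moving the last summand to the other side puts the rest into
        \<open>Y1\<close>, over which the induction hypothesis gives independence.\<close>
      have "(\<Sum>j<m. u j) = (\<Sum>j<Suc m. u j) + (- u m)" by simp
      moreover have "- u m \<in> S" using um sS by (simp add: stable_def subspace_neg)
      ultimately have "(\<Sum>j<m. u j) \<in> Y1" unfolding Y1_def using u(2) by blast
      with ind uj have z: "\<forall>j<m. u j = 0" by blast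
      then have "(\<Sum>j<m. u j) = 0" by simp
      then have "u m \<in> Y" using u(2) by simp
      with um YS have "u m = 0" by blast
      with z u(3) show "u j = 0" by (auto simp: less_Suc_eq)
    qed
  qed
qed

text \<open>Has the shape of \<open>cycle_module\<close> with an arbitrary carrier, so that
  \<open>reduced_homology\<close> becomes an instance by unfolding.\<close>

definition subspace_module :: "'v set \<Rightarrow> ('a, 'v) module" where
  "subspace_module Z = \<lparr>carrier = Z, monoid.mult = undefined, one = undefined, zero = 0,
     add = (\<lambda>v w. v + w), module.smult = scale\<rparr>"

definition coset :: "'v set \<Rightarrow> 'v \<Rightarrow> 'v set" where
  "coset B v = (\<lambda>b. b + v) ` B"

end

section \<open>Quotients of stable subspaces as modules of cosets\<close>

locale linear_action_quotient = linear_action +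
  fixes Z B
  assumes Z: "stable Z" and B: "stable B" and B_subset_Z: "B \<subseteq> Z"
begin

abbreviation "V \<equiv> quotient_module (subspace_module Z) B"

lemma r_coset_eq: "B +>\<^bsub>subspace_module Z\<^esub> v = coset B v"
  by (auto simp: a_r_coset_def r_coset_def subspace_module_def coset_def)

lemma B_sub: "subspace B" and Z_sub: "subspace Z"
  using Z B by (auto simp: stable_def)

lemma mem_coset_iff: "w \<in> coset B v \<longleftrightarrow> w - v \<in> B"
proof
  assume "w - v \<in> B"
  then have "(w - v) + v \<in> coset B v" unfolding coset_def by blast
  then show "w \<in> coset B v" by simp
qed (auto simp: coset_def)

lemma coset_eq_iff: "coset B v = coset B w \<longleftrightarrow> v - w \<in> B"
proof
  assume "coset B v = coset B w"
  moreover have "v \<in> coset B v" using subspace_0[OF B_sub] by (simp add: mem_coset_iff)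
  ultimately show "v - w \<in> B" by (simp add: mem_coset_iff)
next
  assume vw: "v - w \<in> B"
  have "x - v \<in> B \<longleftrightarrow> x - w \<in> B" for x
    using subspace_add[OF B_sub _ vw, of "x - v"] subspace_diff[OF B_sub _ vw, of "x - w"] by auto
  then show "coset B v = coset B w"
    by (auto simp: mem_coset_iff)
qed

lemma coset_zero: "coset B 0 = B"
  by (simp add: coset_def)

lemma carrier_V: "carrier V = coset B ` Z"
  by (auto simp: quotient_module_def A_RCOSETS_def' r_coset_eq) (auto simp: subspace_module_def)

lemma zero_V: "\<zero>\<^bsub>V\<^esub> = coset B 0"
  by (simp add: quotient_module_def coset_zero)

lemma add_V: "coset B v \<oplus>\<^bsub>V\<^esub> coset B w = coset B (v + w)"
proof -
  have "coset B v \<oplus>\<^bsub>V\<^esub> coset B w = {x + y |x y. x \<in> coset B v \<and> y \<in> coset B w}"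
    by (auto simp: quotient_module_def set_add_def' subspace_module_def)
  also have "\<dots> = coset B (v + w)"
  proof (intro Set.set_eqI iffI)
    fix t assume "t \<in> {x + y |x y. x \<in> coset B v \<and> y \<in> coset B w}"
    then obtain x y where "t = x + y" "x - v \<in> B" "y - w \<in> B" by (auto simp: mem_coset_iff)
    then show "t \<in> coset B (v + w)"
      using subspace_add[OF B_sub, of "x - v" "y - w"] by (simp add: mem_coset_iff algebra_simps)
  next
    fix t assume "t \<in> coset B (v + w)"
    then have "t = (t - w) + w" "t - w \<in> coset B v" "w \<in> coset B w"
      using subspace_0[OF B_sub] by (auto simp: mem_coset_iff algebra_simps)
    then show "t \<in> {x + y |x y. x \<in> coset B v \<and> y \<in> coset B w}" by blast
  qed
  finally show ?thesis .
qed

text \<open>The union over representatives in \<open>quotient_module\<close> collapses, since all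
  representatives yield the same coset.\<close>

lemma smult_V: "a \<odot>\<^bsub>V\<^esub> coset B v = coset B (a *s v)"
proof -
  have "a \<odot>\<^bsub>V\<^esub> coset B v = (\<Union>x\<in>coset B v. coset B (a *s x))"
    by (simp add: quotient_module_def r_coset_eq) (simp add: subspace_module_def)
  also have "\<dots> = (\<Union>x\<in>coset B v. coset B (a *s v))"
    by (intro SUP_cong refl)
      (use subspace_scale[OF B_sub] in \<open>auto simp: coset_eq_iff mem_coset_iff simp flip: scale_right_diff_distrib\<close>)
  also have "\<dots> = coset B (a *s v)"
    using subspace_0[OF B_sub] by (auto simp: coset_def)
  finally show ?thesis .
qed

text \<open>One inclusion uses stability of \<open>B\<close> under \<open>g\<close>, the other
  stability under \<open>inv g\<close>.\<close>

lemma action_coset: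
  assumes "g \<in> carrier G"
  shows "\<rho> g ` coset B v = coset B (\<rho> g v)"
proof (intro Set.set_eqI iffI)
  fix t assume "t \<in> coset B (\<rho> g v)"
  then have "\<rho> (inv g) (t - \<rho> g v) \<in> B"
    using stable_action[OF B] assms by (simp add: mem_coset_iff)
  then have "\<rho> (inv g) t \<in> coset B v"
    using assms action_mult[of "inv g" g v] by (simp add: action_diff mem_coset_iff action_one)
  moreover have "t = \<rho> g (\<rho> (inv g) t)" using assms by (simp add: action_inv_cancel)
  ultimately show "t \<in> \<rho> g ` coset B v" by blast
next
  fix t assume "t \<in> \<rho> g ` coset B v"
  then show "t \<in> coset B (\<rho> g v)"
    using stable_action[OF B] assms by (auto simp: mem_coset_iff simp flip: action_diff)
qed

lemma abelian_group_V: "abelian_group V"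
proof (rule abelian_groupI)
  fix x assume "x \<in> carrier V"
  then obtain z where z: "z \<in> Z" "x = coset B z" by (auto simp: carrier_V)
  show "\<exists>y\<in>carrier V. y \<oplus>\<^bsub>V\<^esub> x = \<zero>\<^bsub>V\<^esub>"
    using z subspace_neg[OF Z_sub, of z]
    by (intro bexI[of _ "coset B (- z)"]) (auto simp: carrier_V add_V zero_V)
next
  fix x y assume "x \<in> carrier V" "y \<in> carrier V"
  then show "x \<oplus>\<^bsub>V\<^esub> y = y \<oplus>\<^bsub>V\<^esub> x"
    by (auto simp: carrier_V add_V) (simp_all add: add.commute)
qed (auto simp: carrier_V add_V zero_V add.assoc subspace_add[OF Z_sub] subspace_0[OF Z_sub])

lemma finsum_V:
  assumes "finite A" "\<And>j. j \<in> A \<Longrightarrow> f j = coset B (u j)" "\<And>j. j \<in> A \<Longrightarrow> u j \<in> Z"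
  shows "finsum V f A = coset B (\<Sum>j\<in>A. u j)"
proof -
  interpret V: abelian_group V by (rule abelian_group_V)
  show ?thesis
    using assms
  proof (induction A rule: finite_induct)
    case empty
    then show ?case by (simp add: zero_V)
  next
    case (insert j A)
    then show ?case
      by (subst V.finsum_insert) (auto simp: carrier_V add_V Pi_iff)
  qed
qed

abbreviation "K \<equiv> (ring_of_type_algebra :: 'a ring)"

abbreviation \<tau> :: "'c \<Rightarrow> 'b set \<Rightarrow> 'b set" where "\<tau> g A \<equiv> \<rho> g ` A"

lemma subrepresentation_coset_image:
  assumes "stable S" "S \<subseteq> Z"
  shows "subrepresentation G K V \<tau> (coset B ` S)"
proof -
  interpret V: abelian_group V by (rule abelian_group_V)
  have sub: "subspace S" using assms by (simp add: stable_def)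
  have "subgroup (coset B ` S) (add_monoid V)"
  proof (rule group.subgroupI[OF V.a_group])
    fix x assume "x \<in> coset B ` S"
    then obtain s where s: "s \<in> S" "x = coset B s" by blast
    have "coset B (- s) = m_inv (add_monoid V) x"
      by (rule group.inv_equality[OF V.a_group, symmetric])
        (use s assms subspace_neg[OF Z_sub, of s] in \<open>auto simp: add_V carrier_V zero_V\<close>)
    moreover have "- s \<in> S" using s subspace_neg[OF sub] by blast
    ultimately show "m_inv (add_monoid V) x \<in> coset B ` S" by blast
  qed (use assms subspace_0[OF sub] subspace_add[OF sub] in \<open>auto simp: carrier_V add_V\<close>)
  then have "submodule (coset B ` S) K V"
    by (intro submodule.intro submodule_axioms.intro)
      (auto simp: smult_V subspace_scale[OF sub])
  then show ?thesis
    unfolding subrepresentation_def using stable_action[OF assms(1)]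
    by (auto simp: action_coset)
qed

lemma stable_coset_vimage:
  assumes W: "subrepresentation G K V \<tau> W" and "stable S" "S \<subseteq> Z"
  shows "stable {s \<in> S. coset B s \<in> W}"
proof -
  interpret W: submodule W K V using W by (simp add: subrepresentation_def)
  have sub: "subspace S" using assms by (simp add: stable_def)
  have "coset B 0 \<in> W" using W.one_closed by (simp add: zero_V)
  moreover have "coset B (x + y) \<in> W" if "coset B x \<in> W" "coset B y \<in> W" for x y
    using W.m_closed[OF that] by (simp add: add_V)
  moreover have "coset B (c *s x) \<in> W" if "coset B x \<in> W" for c x
    using W.smult_closed[OF _ that, of c] by (simp add: smult_V ring_of_type_algebra_def)
  moreover have "coset B (\<rho> g x) \<in> W" if "g \<in> carrier G" "coset B x \<in> W" for g x
    using W that by (auto simp: subrepresentation_def simp flip: action_coset)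
  ultimately show ?thesis
    unfolding stable_def subspace_def
    using subspace_0[OF sub] subspace_add[OF sub] subspace_scale[OF sub] stable_action[OF assms(2)]
    by auto
qed

text \<open>No nonzero element of \<open>S\<close> dies in the quotient, because \<open>S\<close>
  meets \<open>B\<close> in 0. A subrepresentation of the image is the image of its preimage in
  \<open>S\<close>, and that preimage is stable, hence 0 or \<open>S\<close>.\<close>

lemma irreducible_coset_image:
  assumes S: "simple S" "S \<subseteq> Z" "S \<inter> B = {0}"
  shows "irreducible_subrepresentation G K V \<tau> (coset B ` S)"
  unfolding irreducible_subrepresentation_def
proof (intro conjI allI impI)
  have st: "stable S" using S by (simp add: simple_def)
  have "S \<noteq> {}" using st by (auto simp: stable_def subspace_def)
  show "subrepresentation G K V \<tau> (coset B ` S)"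
    by (rule subrepresentation_coset_image[OF st S(2)])
  show "coset B ` S \<noteq> {\<zero>\<^bsub>V\<^esub>}"
  proof
    assume eq: "coset B ` S = {\<zero>\<^bsub>V\<^esub>}"
    have "s = 0" if "s \<in> S" for s
    proof -
      have "coset B s = coset B 0" using eq that zero_V by blast
      then show ?thesis using S(3) that by (auto simp: coset_eq_iff)
    qed
    then show False using S(1) \<open>S \<noteq> {}\<close> by (auto simp: simple_def)
  qed
next
  fix W assume W: "subrepresentation G K V \<tau> W" "W \<subseteq> coset B ` S"
  have "stable {s \<in> S. coset B s \<in> W}"
    by (rule stable_coset_vimage[OF W(1)]) (use S in \<open>auto simp: simple_def\<close>)
  then have "{s \<in> S. coset B s \<in> W} = {0} \<or> {s \<in> S. coset B s \<in> W} = S"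
    using S(1) unfolding simple_def by blast
  moreover have "W = coset B ` {s \<in> S. coset B s \<in> W}" using W(2) by blast
  ultimately show "W = {\<zero>\<^bsub>V\<^esub>} \<or> W = coset B ` S"
    using zero_V by auto
qed

lemma irreducible_decomposition_exists:
  assumes "Z \<subseteq> span D" "finite D"
  shows "\<exists>m U. irreducible_decomposition G K V \<tau> m U"
proof -
  obtain m :: nat and U where U: "\<forall>j<m. simple (U j) \<and> U j \<subseteq> Z"
    and gen: "\<forall>z\<in>Z. \<exists>u. (\<forall>j<m. u j \<in> U j) \<and> z - (\<Sum>j<m. u j) \<in> B"
    and ind': "\<forall>u. (\<forall>j<m. u j \<in> U j) \<longrightarrow> (\<Sum>j<m. u j) \<in> B \<longrightarrow> (\<forall>j<m. u j = 0)"
    using simple_decomposition_over[OF B Z B_subset_Z assms] by (elim exE conjE) (rule that)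
  note ind = ind'[rule_format]
  have sub: "subspace (U j)" if "j < m" for j
    using U that by (simp add: simple_def stable_def)
  have "U j \<inter> B = {0}" if "j < m" for j
  proof -
    have "x = 0" if x: "x \<in> U j" "x \<in> B" for x
    proof -
      \<comment> \<open>The family with \<open>x\<close> at position \<open>j\<close> and 0
        elsewhere turns independence modulo \<open>B\<close> into triviality of the
        intersection.\<close>
      have "(\<Sum>i<m. if i = j then x else 0) = x" using \<open>j < m\<close> by simp
      then show ?thesis
        using ind[of "\<lambda>i. if i = j then x else 0" j] x \<open>j < m\<close> sub by (auto simp: subspace_0)
    qed
    then show ?thesis using subspace_0[OF sub[OF that]] subspace_0[OF B_sub] by auto
  qed
  then have irr: "irreducible_subrepresentation G K V \<tau> (coset B ` U j)" if "j < m" for j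
    using irreducible_coset_image U that by blast
  have "\<exists>!u. u \<in> (\<Pi>\<^sub>E j\<in>{..<m}. coset B ` U j) \<and> v = finsum V u {..<m}"
    if v: "v \<in> carrier V" for v
  proof -
    obtain z where z: "z \<in> Z" "v = coset B z" using v by (auto simp: carrier_V)
    obtain u where u: "\<forall>j<m. u j \<in> U j" "z - (\<Sum>j<m. u j) \<in> B" using gen z by blast
    have UZ: "x \<in> Z" if "j < m" "x \<in> U j" for j x using U that by blast
    show ?thesis
    proof (rule ex1I[of _ "\<lambda>j\<in>{..<m}. coset B (u j)"])
      show "(\<lambda>j\<in>{..<m}. coset B (u j)) \<in> (\<Pi>\<^sub>E j\<in>{..<m}. coset B ` U j)
          \<and> v = finsum V (\<lambda>j\<in>{..<m}. coset B (u j)) {..<m}"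
        using u UZ by (subst finsum_V[where u = u]) (auto simp: z coset_eq_iff)
    next
      fix w assume w: "w \<in> (\<Pi>\<^sub>E j\<in>{..<m}. coset B ` U j) \<and> v = finsum V w {..<m}"
      then have "\<forall>j\<in>{..<m}. \<exists>x. x \<in> U j \<and> w j = coset B x"
        by (auto simp: PiE_iff)
      then obtain x where x: "\<And>j. j < m \<Longrightarrow> x j \<in> U j" "\<And>j. j < m \<Longrightarrow> w j = coset B (x j)"
        by (metis lessThan_iff)
      have "v = coset B (\<Sum>j<m. x j)"
        using w x UZ finsum_V[of "{..<m}" w x] by auto
      then have "z - (\<Sum>j<m. x j) \<in> B" by (simp add: z coset_eq_iff)
      then have "(z - (\<Sum>j<m. u j)) - (z - (\<Sum>j<m. x j)) \<in> B"
        by (rule subspace_diff[OF B_sub u(2)])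
      then have "(\<Sum>j<m. x j - u j) \<in> B" by (simp add: sum_subtractf)
      then have "x j - u j = 0" if "j < m" for j
        using x(1) u(1) sub that by (intro ind[of "\<lambda>j. x j - u j"]) (auto intro: subspace_diff)
      then show "w = (\<lambda>j\<in>{..<m}. coset B (u j))"
        using w x(2) by (auto simp: fun_eq_iff PiE_iff extensional_def)
    qed
  qed
  with irr have "irreducible_decomposition G K V \<tau> m (\<lambda>j. coset B ` U j)"
    unfolding irreducible_decomposition_def by (intro conjI allI impI ballI)
  then show ?thesis by (intro exI)
qed

text \<open>A trivial summand is spanned by the class of some \<open>z\<close> with all
  \<open>z - \<rho> g z\<close> in \<open>B\<close>. The orbit sum of \<open>z\<close> is invariant,
  hence in \<open>B\<close>; adding the differences puts |G| z, and so \<open>z\<close>, into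
  \<open>B\<close>. Thus every decomposition has 0 trivial summands, and the existence of one makes
  the \<open>THE\<close> proper.\<close>

theorem trivial_multiplicity_eq_0:
  assumes fin: "Z \<subseteq> span D" "finite D"
    and inv: "\<And>z. z \<in> Z \<Longrightarrow> (\<And>g. g \<in> carrier G \<Longrightarrow> \<rho> g z = z) \<Longrightarrow> z \<in> B"
  shows "trivial_multiplicity G K V \<tau> = 0"
proof -
  have no_trivial: "\<not> trivial_subrepresentation G K V \<tau> U" for U
  proof
    assume triv: "trivial_subrepresentation G K V \<tau> U"
    then obtain v where v: "v \<in> carrier V" "v \<noteq> \<zero>\<^bsub>V\<^esub>" "U = {a \<odot>\<^bsub>V\<^esub> v | a. a \<in> carrier K}"
      and fixed: "\<And>g u. g \<in> carrier G \<Longrightarrow> u \<in> U \<Longrightarrow> \<tau> g u = u"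
      unfolding trivial_subrepresentation_def by auto
    obtain z where z: "z \<in> Z" "v = coset B z" using v(1) by (auto simp: carrier_V)
    have "v = 1 \<odot>\<^bsub>V\<^esub> v" by (simp add: z smult_V)
    then have "v \<in> U" using v(3) by (auto simp: ring_of_type_algebra_def)
    then have "coset B (\<rho> g z) = coset B z" if "g \<in> carrier G" for g
      using fixed[OF that, of v] action_coset[OF that] z by simp
    then have diff: "z - \<rho> g z \<in> B" if "g \<in> carrier G" for g
      using that coset_eq_iff by metis
    let ?s = "\<Sum>g\<in>carrier G. \<rho> g z"
    have "?s \<in> B"
      using stable_action[OF Z _ z(1)]
      by (intro inv subspace_sum[OF Z_sub] invariant_orbit_sum)
    moreover have "(\<Sum>g\<in>carrier G. z - \<rho> g z) \<in> B"
      by (rule subspace_sum[OF B_sub diff])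
    ultimately have "of_nat (card (carrier G)) *s z \<in> B"
      using subspace_add[OF B_sub, of ?s "\<Sum>g\<in>carrier G. z - \<rho> g z"]
      by (simp add: sum_subtractf sum_const_scale[OF finite_group])
    then have "inverse (of_nat (card (carrier G))) *s of_nat (card (carrier G)) *s z \<in> B"
      by (rule subspace_scale[OF B_sub])
    then have "z \<in> B" using card_group_nonzero by simp
    then show False using v(2) by (simp add: z zero_V coset_eq_iff)
  qed
  show ?thesis
    unfolding trivial_multiplicity_def
  proof (rule the_equality)
    show "\<exists>m U. irreducible_decomposition G K V \<tau> m U \<and>
        0 = card {j. j < m \<and> trivial_subrepresentation G K V \<tau> (U j)}"
      using irreducible_decomposition_exists[OF fin] by (simp only: no_trivial) simp
  qed (elim exE conjE, simp add: no_trivial)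
qed

end

section \<open>The chain complex of a finite poset\<close>

text \<open>The sign with which \<open>\<tau>\<close> occurs in the boundary of
  \<open>insert x \<tau>\<close>, for \<open>x\<close> outside \<open>\<tau>\<close>. Indexing by
  the face suits a boundary that is evaluated pointwise.\<close>

definition incidence_sign :: "('p \<Rightarrow> 'p \<Rightarrow> bool) \<Rightarrow> 'p \<Rightarrow> 'p set \<Rightarrow> 'a::field" where
  "incidence_sign leq x \<tau> = (-1) ^ card {y \<in> \<tau>. leq y x}"

lemma incidence_sign_square: "incidence_sign leq x \<tau> * incidence_sign leq x \<tau> = (1::'a::field)"
  by (simp add: incidence_sign_def flip: power_add mult_2)

lemma incidence_sign_insert:
  assumes "finite \<tau>" "x \<notin> \<tau>"
  shows "incidence_sign leq y (insert x \<tau>)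
    = (if leq x y then - incidence_sign leq y \<tau> else (incidence_sign leq y \<tau> :: 'a::field))"
proof (cases "leq x y")
  case True
  then have "{z \<in> insert x \<tau>. leq z y} = insert x {z \<in> \<tau>. leq z y}" by auto
  then show ?thesis using assms True by (simp add: incidence_sign_def)
next
  case False
  then have "{z \<in> insert x \<tau>. leq z y} = {z \<in> \<tau>. leq z y}" by auto
  then show ?thesis using False by (simp add: incidence_sign_def)
qed

text \<open>Adding the lower vertex shifts the position of the upper one but not conversely, so
  exactly one sign changes.\<close>

lemma incidence_sign_swap:
  assumes "finite \<tau>" "x \<notin> \<tau>" "y \<notin> \<tau>" "leq x y \<longleftrightarrow> \<not> leq y x"
  shows "incidence_sign leq x \<tau> * incidence_sign leq y (insert x \<tau>)
    = - (incidence_sign leq y \<tau> * (incidence_sign leq x (insert y \<tau>) :: 'a::field))"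
  using assms by (auto simp: incidence_sign_insert)

locale finite_order =
  fixes P :: "'p set" and leq :: "'p \<Rightarrow> 'p \<Rightarrow> bool"
  assumes finite_P: "finite P"
    and leq_refl: "x \<in> P \<Longrightarrow> leq x x"
    and leq_antisym: "x \<in> P \<Longrightarrow> y \<in> P \<Longrightarrow> leq x y \<Longrightarrow> leq y x \<Longrightarrow> x = y"
begin

abbreviation "OC \<equiv> order_complex P leq"

lemma OC_subset: "\<sigma> \<in> OC \<Longrightarrow> \<tau> \<subseteq> \<sigma> \<Longrightarrow> \<tau> \<in> OC"
  using finite_subset by (fastforce simp: order_complex_def)

lemma OC_finite: "\<sigma> \<in> OC \<Longrightarrow> finite \<sigma>"
  by (simp add: order_complex_def)

lemma OC_in_P: "\<sigma> \<in> OC \<Longrightarrow> x \<in> \<sigma> \<Longrightarrow> x \<in> P"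
  by (auto simp: order_complex_def)

lemma OC_total:
  assumes "\<sigma> \<in> OC" "x \<in> \<sigma>" "y \<in> \<sigma>" "x \<noteq> y"
  shows "leq x y \<longleftrightarrow> \<not> leq y x"
  using assms leq_antisym unfolding order_complex_def by blast

lemma finite_OC: "finite OC"
  by (rule finite_subset[of _ "Pow P"]) (auto simp: order_complex_def finite_P)

lemma mem_chain_space:
  "c \<in> chain_space P leq i \<longleftrightarrow> (\<forall>\<sigma>. c \<sigma> \<noteq> 0 \<longrightarrow> \<sigma> \<in> OC \<and> int (card \<sigma>) = i + 1)"
proof -
  have "finite {\<sigma>. c \<sigma> \<noteq> 0}" if "\<forall>\<sigma>. c \<sigma> \<noteq> 0 \<longrightarrow> \<sigma> \<in> OC \<and> int (card \<sigma>) = i + 1"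
    by (rule finite_subset[OF _ finite_OC]) (use that in auto)
  then show ?thesis by (auto simp: chain_space_def)
qed

lemma chain_space_zero: "0 \<in> chain_space P leq i"
  by (simp add: mem_chain_space)

lemma chain_space_add:
  assumes "c \<in> chain_space P leq i" "d \<in> chain_space P leq i"
  shows "c + d \<in> chain_space P leq i"
  unfolding mem_chain_space
proof (intro allI impI)
  fix \<sigma> assume "(c + d) \<sigma> \<noteq> 0"
  then have "c \<sigma> \<noteq> 0 \<or> d \<sigma> \<noteq> 0" by auto
  then show "\<sigma> \<in> OC \<and> int (card \<sigma>) = i + 1" using assms unfolding mem_chain_space by blast
qed

lemma chain_space_scale:
  assumes "c \<in> chain_space P leq i"
  shows "(\<lambda>\<sigma>. a * c \<sigma>) \<in> chain_space P leq i"
  using assms unfolding mem_chain_space by auto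

lemma chain_space_diff:
  assumes "c \<in> chain_space P leq i" "d \<in> chain_space P leq i"
  shows "c - d \<in> chain_space P leq i"
  using chain_space_add[OF assms(1) chain_space_scale[OF assms(2), of "- 1"]]
  by (simp add: fun_diff_def plus_fun_def)

text \<open>The boundary as a sum over the vertices that can be added to a face. The index set does
  not depend on the support of \<open>c\<close>, so linearity and naturality become manipulations of
  finite sums.\<close>

definition del :: "('p set \<Rightarrow> 'a::field) \<Rightarrow> 'p set \<Rightarrow> 'a" where
  "del c \<tau> = (\<Sum>x\<in>P - \<tau>. incidence_sign leq x \<tau> * c (insert x \<tau>))"

lemma boundary_eq_del:
  fixes c :: "'p set \<Rightarrow> 'a::field"
  assumes c: "c \<in> chain_space P leq i"
  shows "boundary leq c = del c"
proof
  fix \<tau>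
  let ?S = "{\<sigma>. c \<sigma> \<noteq> 0}"
  have "finite ?S" using c by (simp add: chain_space_def)
  \<comment> \<open>The conditional makes the ranges of simplex and vertex independent, so that the
    two sums can be exchanged.\<close>
  have "boundary leq c \<tau>
      = (\<Sum>\<sigma>\<in>?S. \<Sum>x\<in>P - \<tau>. if \<sigma> = insert x \<tau> then incidence_sign leq x \<tau> * c \<sigma> else 0)"
    unfolding boundary_def
  proof (rule sum.cong[OF refl])
    fix \<sigma> assume "\<sigma> \<in> ?S"
    then have "\<sigma> \<in> OC" using c by (simp add: mem_chain_space)
    have "(\<Sum>x | x \<in> \<sigma> \<and> \<sigma> - {x} = \<tau>. (-1) ^ card {y \<in> \<sigma>. y \<noteq> x \<and> leq y x})
      = (\<Sum>x\<in>{x \<in> P - \<tau>. \<sigma> = insert x \<tau>}. incidence_sign leq x \<tau> :: 'a)"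
    proof (rule sum.cong)
      show "{x. x \<in> \<sigma> \<and> \<sigma> - {x} = \<tau>} = {x \<in> P - \<tau>. \<sigma> = insert x \<tau>}"
        using OC_in_P[OF \<open>\<sigma> \<in> OC\<close>] by auto
      fix x assume "x \<in> {x \<in> P - \<tau>. \<sigma> = insert x \<tau>}"
      then have "{y \<in> \<sigma>. y \<noteq> x \<and> leq y x} = {y \<in> \<tau>. leq y x}" by auto
      then show "(-1) ^ card {y \<in> \<sigma>. y \<noteq> x \<and> leq y x} = (incidence_sign leq x \<tau> :: 'a)"
        by (simp add: incidence_sign_def)
    qed
    also have "\<dots> = (\<Sum>x\<in>P - \<tau>. if \<sigma> = insert x \<tau> then incidence_sign leq x \<tau> else 0)"
      by (rule sum.inter_filter) (simp add: finite_P)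
    finally show "c \<sigma> * (\<Sum>x | x \<in> \<sigma> \<and> \<sigma> - {x} = \<tau>. (-1) ^ card {y \<in> \<sigma>. y \<noteq> x \<and> leq y x})
      = (\<Sum>x\<in>P - \<tau>. if \<sigma> = insert x \<tau> then incidence_sign leq x \<tau> * c \<sigma> else 0)"
      by (auto simp: sum_distrib_left intro!: sum.cong)
  qed
  also have "\<dots> = (\<Sum>x\<in>P - \<tau>. \<Sum>\<sigma>\<in>?S. if \<sigma> = insert x \<tau> then incidence_sign leq x \<tau> * c \<sigma> else 0)"
    by (rule sum.swap)
  also have "\<dots> = del c \<tau>"
    unfolding del_def using \<open>finite ?S\<close> by (intro sum.cong) auto
  finally show "boundary leq c \<tau> = del c \<tau>" .
qed

lemma del_add: "del (c + d) = del c + del d"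
  by (auto simp: del_def fun_eq_iff sum.distrib algebra_simps)

lemma del_diff: "del (c - d) = del c - del d"
  by (auto simp: del_def fun_eq_iff sum_subtractf algebra_simps)

lemma del_scale: "del (\<lambda>\<sigma>. a * c \<sigma>) = (\<lambda>\<sigma>. a * del c \<sigma>)"
  by (auto simp: del_def fun_eq_iff sum_distrib_left algebra_simps)

lemma del_nonzeroE:
  assumes "del c \<tau> \<noteq> 0"
  obtains x where "x \<in> P - \<tau>" "c (insert x \<tau>) \<noteq> 0"
proof -
  have "\<exists>x\<in>P - \<tau>. incidence_sign leq x \<tau> * c (insert x \<tau>) \<noteq> 0"
    using assms unfolding del_def by (meson sum.neutral)
  then show thesis using that by auto
qed

lemma del_chain_space:
  assumes "c \<in> chain_space P leq (i + 1)"
  shows "del c \<in> chain_space P leq i"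
  unfolding mem_chain_space
proof (intro allI impI)
  fix \<tau> assume "del c \<tau> \<noteq> 0"
  then obtain x where x: "x \<in> P - \<tau>" "c (insert x \<tau>) \<noteq> 0" by (rule del_nonzeroE)
  then have \<sigma>: "insert x \<tau> \<in> OC" "int (card (insert x \<tau>)) = i + 2"
    using assms unfolding mem_chain_space by (simp_all add: algebra_simps)
  then have "\<tau> \<in> OC" using OC_subset by blast
  with x \<sigma> show "\<tau> \<in> OC \<and> int (card \<tau>) = i + 1"
    by (auto dest: OC_finite)
qed

text \<open>The double sum runs over ordered pairs of distinct new vertices. Exchanging the two
  negates each term, so the sum is its own negative and vanishes because 2 is nonzero.\<close>

lemma del_del:
  fixes c :: "'p set \<Rightarrow> 'a::field"
  assumes c: "c \<in> chain_space P leq i" and two: "(2::'a) \<noteq> 0"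
  shows "del (del c) = 0"
proof
  fix \<tau>
  define f :: "'p \<times> 'p \<Rightarrow> 'a" where "f = (\<lambda>(x, y). incidence_sign leq x \<tau> * incidence_sign leq y (insert x \<tau>)
    * c (insert y (insert x \<tau>)))"
  let ?R = "{(x, y). x \<in> P - \<tau> \<and> y \<in> P - \<tau> \<and> x \<noteq> y}"
  have "del (del c) \<tau> = (\<Sum>x\<in>P - \<tau>. \<Sum>y\<in>P - insert x \<tau>. f (x, y))"
    by (simp add: del_def f_def sum_distrib_left mult.assoc)
  also have "\<dots> = sum f (SIGMA x:P - \<tau>. P - insert x \<tau>)"
    using finite_P by (subst sum.Sigma) auto
  also have "(SIGMA x:P - \<tau>. P - insert x \<tau>) = ?R" by auto
  finally have D: "del (del c) \<tau> = sum f ?R" .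
  have "sum f ?R = sum (f \<circ> prod.swap) ?R"
    by (rule sum.reindex_bij_witness[of _ prod.swap prod.swap]) auto
  also have "\<dots> = (\<Sum>p\<in>?R. - f p)"
  proof (rule sum.cong[OF refl])
    fix p assume "p \<in> ?R"
    then obtain x y where p: "p = (x, y)" "x \<in> P - \<tau>" "y \<in> P - \<tau>" "x \<noteq> y" by auto
    show "(f \<circ> prod.swap) p = - f p"
    \<comment> \<open>Comparability of \<open>x\<close> and \<open>y\<close> is available only if
      the simplex lies in the support of \<open>c\<close>; otherwise both terms are 0.\<close>
    proof (cases "c (insert x (insert y \<tau>)) = 0")
      case True
      then show ?thesis by (simp add: f_def p insert_commute)
    next
      case False
      then have \<sigma>: "insert x (insert y \<tau>) \<in> OC" using c by (simp add: mem_chain_space)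
      have "leq x y \<longleftrightarrow> \<not> leq y x" by (rule OC_total[OF \<sigma>]) (use p in auto)
      moreover have "finite \<tau>" using OC_finite[OF \<sigma>] by simp
      ultimately have "incidence_sign leq y \<tau> * incidence_sign leq x (insert y \<tau>)
          = - (incidence_sign leq x \<tau> * (incidence_sign leq y (insert x \<tau>) :: 'a))"
        by (intro incidence_sign_swap) (use p in auto)
      then show ?thesis by (simp add: f_def p insert_commute)
    qed
  qed
  also have "\<dots> = - sum f ?R" by (simp add: sum_negf)
  finally have "2 * sum f ?R = 0" by simp
  with two D show "del (del c) \<tau> = 0 \<tau>" by simp
qed

lemma boundaries_eq: "boundaries P leq i = del ` chain_space P leq (i + 1)"
  unfolding boundaries_def by (auto simp: boundary_eq_del)

lemma cycles_eq: "cycles P leq i = {c \<in> chain_space P leq i. del c = 0}"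
  unfolding cycles_def by (auto simp: boundary_eq_del zero_fun_def)

lemma boundaries_subset_cycles:
  assumes "(2::'a::field) \<noteq> 0"
  shows "(boundaries P leq i :: ('p set \<Rightarrow> 'a) set) \<subseteq> cycles P leq i"
  unfolding boundaries_eq cycles_eq using assms by (auto simp: del_chain_space del_del)

end

section \<open>Invariant cycles\<close>

text \<open>The action is on the whole type, so each \<open>\<phi> g\<close> is injective everywhere
  and images of arbitrary sets can be undone by \<open>inv g\<close>.\<close>

locale finite_order_action = finite_order P leq + group G
  for P :: "'p set" and leq and G :: "('g, 'x) monoid_scheme" (structure) +
  fixes \<phi> :: "'g \<Rightarrow> 'p \<Rightarrow> 'p"
  assumes finite_G: "finite (carrier G)"
    and \<phi>_mult: "g \<in> carrier G \<Longrightarrow> h \<in> carrier G \<Longrightarrow> \<phi> (g \<otimes> h) x = \<phi> g (\<phi> h x)"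
    and \<phi>_one: "\<phi> \<one> x = x"
    and \<phi>_P: "g \<in> carrier G \<Longrightarrow> x \<in> P \<Longrightarrow> \<phi> g x \<in> P"
    and \<phi>_leq: "g \<in> carrier G \<Longrightarrow> x \<in> P \<Longrightarrow> y \<in> P \<Longrightarrow> leq (\<phi> g x) (\<phi> g y) \<longleftrightarrow> leq x y"
begin

definition invariant :: "('p set \<Rightarrow> 'b) \<Rightarrow> bool" where
  "invariant c \<longleftrightarrow> (\<forall>g\<in>carrier G. \<forall>\<sigma>. c (\<phi> g ` \<sigma>) = c \<sigma>)"

lemma \<phi>_inv1: "g \<in> carrier G \<Longrightarrow> \<phi> (inv g) (\<phi> g x) = x"
  and \<phi>_inv2: "g \<in> carrier G \<Longrightarrow> \<phi> g (\<phi> (inv g) x) = x"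
  by (simp_all add: \<phi>_one flip: \<phi>_mult)

lemma inj_\<phi>: "g \<in> carrier G \<Longrightarrow> inj (\<phi> g)"
  by (metis \<phi>_inv1 injI)

lemma \<phi>_image_eq:
  assumes "g \<in> carrier G" "\<And>h x. h \<in> carrier G \<Longrightarrow> x \<in> A \<Longrightarrow> \<phi> h x \<in> A"
  shows "\<phi> g ` A = A"
  using assms by (metis \<phi>_inv2 image_subset_iff inv_closed rev_image_eqI subsetI subset_antisym)

lemma \<phi>_image_P: "g \<in> carrier G \<Longrightarrow> \<phi> g ` P = P"
  by (rule \<phi>_image_eq) (auto simp: \<phi>_P)

lemma \<phi>_image_OC:
  assumes "g \<in> carrier G"
  shows "\<phi> g ` \<sigma> \<in> OC \<longleftrightarrow> \<sigma> \<in> OC"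
proof -
  have *: "\<phi> g ` \<sigma> \<in> OC" if "g \<in> carrier G" "\<sigma> \<in> OC" for g \<sigma>
    using that unfolding order_complex_def by (auto simp: \<phi>_P) (metis \<phi>_leq subsetD)
  have "\<phi> (inv g) ` \<phi> g ` \<sigma> = \<sigma>" using assms by (simp add: image_image \<phi>_inv1)
  then show ?thesis using *[OF assms] *[of "inv g" "\<phi> g ` \<sigma>"] assms by auto
qed

lemma card_\<phi>_image: "g \<in> carrier G \<Longrightarrow> card (\<phi> g ` A) = card A"
  by (meson card_image inj_\<phi> inj_on_subset subset_UNIV)

lemma incidence_sign_\<phi>:
  assumes "g \<in> carrier G" "x \<in> P" "\<tau> \<subseteq> P"
  shows "incidence_sign leq (\<phi> g x) (\<phi> g ` \<tau>) = incidence_sign leq x \<tau>"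
proof -
  have "{y \<in> \<phi> g ` \<tau>. leq y (\<phi> g x)} = \<phi> g ` {y \<in> \<tau>. leq y x}"
    using assms by (auto simp: \<phi>_leq subset_iff)
  then show ?thesis by (simp add: incidence_sign_def card_\<phi>_image assms(1))
qed

text \<open>Reindexing along the bijection \<open>\<phi> g\<close> of \<open>P\<close>, which
  preserves signs on subsets of \<open>P\<close>. If \<open>\<tau>\<close> is not contained in
  \<open>P\<close>, the support condition makes all terms 0.\<close>

lemma del_\<phi>:
  fixes c :: "'p set \<Rightarrow> 'f::field"
  assumes supp: "\<And>\<sigma>. c \<sigma> \<noteq> 0 \<Longrightarrow> \<sigma> \<subseteq> P" and g: "g \<in> carrier G"
  shows "del (\<lambda>\<sigma>. c (\<phi> g ` \<sigma>)) \<tau> = del c (\<phi> g ` \<tau>)"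
proof -
  have "P - \<phi> g ` \<tau> = \<phi> g ` (P - \<tau>)"
    using g by (simp add: image_set_diff inj_\<phi> \<phi>_image_P)
  then have "del c (\<phi> g ` \<tau>)
      = (\<Sum>x\<in>P - \<tau>. incidence_sign leq (\<phi> g x) (\<phi> g ` \<tau>) * c (insert (\<phi> g x) (\<phi> g ` \<tau>)))"
    unfolding del_def
    by (simp add: sum.reindex inj_on_subset[OF inj_\<phi>[OF g]])
  also have "\<dots> = del (\<lambda>\<sigma>. c (\<phi> g ` \<sigma>)) \<tau>"
    unfolding del_def image_insert
  proof (rule sum.cong[OF refl])
    fix x assume x: "x \<in> P - \<tau>"
    show "incidence_sign leq (\<phi> g x) (\<phi> g ` \<tau>) * c (insert (\<phi> g x) (\<phi> g ` \<tau>))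
        = incidence_sign leq x \<tau> * c (insert (\<phi> g x) (\<phi> g ` \<tau>))"
    proof (cases "c (insert (\<phi> g x) (\<phi> g ` \<tau>)) = 0")
      case False
      then have "\<phi> g ` \<tau> \<subseteq> \<phi> g ` P" using supp[of "insert (\<phi> g x) (\<phi> g ` \<tau>)"] \<phi>_image_P[OF g] by simp
      then have "\<tau> \<subseteq> P" using inj_\<phi>[OF g] by (simp add: inj_image_subset_iff)
      then have "incidence_sign leq (\<phi> g x) (\<phi> g ` \<tau>) = (incidence_sign leq x \<tau> :: 'f)"
        using x by (intro incidence_sign_\<phi>[OF g]) auto
      then show ?thesis by simp
    qed simp
  qed
  finally show ?thesis by simp
qed

lemma invariant_del:
  fixes c :: "'p set \<Rightarrow> 'f::field"
  assumes "invariant c" "\<And>\<sigma>. c \<sigma> \<noteq> 0 \<Longrightarrow> \<sigma> \<subseteq> P"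
  shows "invariant (del c)"
  unfolding invariant_def
proof (intro ballI allI)
  fix g \<tau> assume g: "g \<in> carrier G"
  have "(\<lambda>\<sigma>. c (\<phi> g ` \<sigma>)) = c" using assms(1) g by (auto simp: invariant_def)
  then show "del c (\<phi> g ` \<tau>) = del c \<tau>" using del_\<phi>[of c g \<tau>, OF assms(2) g] by simp
qed

text \<open>Pushing forward along a bijection is pulling back along its inverse, which replaces the
  sum over a fibre by a single value.\<close>

lemma chain_map_\<phi>:
  assumes g: "g \<in> carrier G"
  shows "chain_map (\<phi> g) c = (\<lambda>\<tau>. c (\<phi> (inv g) ` \<tau>))"
proof
  fix \<tau>
  have "\<phi> g ` \<sigma> = \<tau> \<longleftrightarrow> \<sigma> = \<phi> (inv g) ` \<tau>" for \<sigma>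
    using g by (auto simp: image_image \<phi>_inv1 \<phi>_inv2)
  then have "{\<sigma>. c \<sigma> \<noteq> 0 \<and> \<phi> g ` \<sigma> = \<tau>} = (if c (\<phi> (inv g) ` \<tau>) \<noteq> 0 then {\<phi> (inv g) ` \<tau>} else {})"
    by auto
  then show "chain_map (\<phi> g) c \<tau> = c (\<phi> (inv g) ` \<tau>)"
    unfolding chain_map_def by (simp split: if_splits)
qed

lemma linear_action_chains:
  assumes "of_nat (card (carrier G)) \<noteq> (0::'f::field)"
  shows "linear_action (\<lambda>(a::'f) c \<sigma>. a * c \<sigma>) G (\<lambda>g. chain_map (\<phi> g))"
proof
  fix g h and v :: "'p set \<Rightarrow> 'f"
  assume "g \<in> carrier G" "h \<in> carrier G"
  then show "chain_map (\<phi> (g \<otimes> h)) v = chain_map (\<phi> g) (chain_map (\<phi> h) v)"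
    by (simp add: chain_map_\<phi> inv_mult_group \<phi>_mult image_image)
qed (use assms in \<open>auto simp: finite_G chain_map_\<phi> fun_eq_iff algebra_simps \<phi>_one\<close>)

lemma chain_space_\<phi>:
  assumes "g \<in> carrier G" "c \<in> chain_space P leq i"
  shows "chain_map (\<phi> g) c \<in> chain_space P leq i"
  unfolding mem_chain_space
proof (intro allI impI)
  fix \<sigma> assume "chain_map (\<phi> g) c \<sigma> \<noteq> 0"
  then have "\<phi> (inv g) ` \<sigma> \<in> OC \<and> int (card (\<phi> (inv g) ` \<sigma>)) = i + 1"
    using assms(2) chain_map_\<phi>[OF assms(1)] unfolding mem_chain_space by metis
  then show "\<sigma> \<in> OC \<and> int (card \<sigma>) = i + 1"
    using \<phi>_image_OC[of "inv g" \<sigma>] card_\<phi>_image[of "inv g" \<sigma>] assms(1) by simp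
qed

lemma del_chain_map:
  fixes c :: "'p set \<Rightarrow> 'f::field"
  assumes "g \<in> carrier G" "c \<in> chain_space P leq i"
  shows "del (chain_map (\<phi> g) c) = chain_map (\<phi> g) (del c)"
proof -
  have "\<sigma> \<subseteq> P" if "c \<sigma> \<noteq> 0" for \<sigma>
    using assms(2) that by (auto simp: mem_chain_space dest: OC_in_P)
  then show ?thesis using del_\<phi>[of c "inv g"] assms(1) by (simp add: chain_map_\<phi> fun_eq_iff)
qed

text \<open>Cycles and boundaries play the roles of \<open>Z\<close> and \<open>B\<close>. The
  indicator functions of the finitely many simplices provide the finite spanning set.\<close>

theorem trivial_multiplicity_homology_eq_0:
  assumes char: "of_nat (card (carrier G)) \<noteq> (0::'f::field)" "(2::'f) \<noteq> 0"
    and inv: "\<And>z :: 'p set \<Rightarrow> 'f. z \<in> cycles P leq i \<Longrightarrow> invariant z \<Longrightarrow> z \<in> boundaries P leq i"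
  shows "trivial_multiplicity G (ring_of_type_algebra :: 'f ring) (reduced_homology P leq i)
    (\<lambda>g A. chain_map (\<phi> g) ` A) = 0"
proof -
  let ?s = "\<lambda>(a::'f) (c :: 'p set \<Rightarrow> 'f) \<sigma>. a * c \<sigma>"
  let ?Z = "cycles P leq i :: ('p set \<Rightarrow> 'f) set" and ?B = "boundaries P leq i :: ('p set \<Rightarrow> 'f) set"
  interpret L: linear_action ?s G "\<lambda>g. chain_map (\<phi> g)"
    by (rule linear_action_chains[OF char(1)])
  have Z: "L.stable ?Z"
    unfolding L.stable_def
  proof (intro conjI ballI L.subspaceI)
    show "0 \<in> ?Z" by (simp add: cycles_eq chain_space_zero del_def fun_eq_iff)
    fix x assume "x \<in> ?Z"
    then have x: "x \<in> chain_space P leq i" "del x = 0" by (auto simp: cycles_eq)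
    show "chain_map (\<phi> g) x \<in> ?Z" if g: "g \<in> carrier G" for g
    proof -
      have "chain_map (\<phi> g) (del x) = 0"
        unfolding x(2) chain_map_\<phi>[OF g] by (simp add: fun_eq_iff)
      then show ?thesis using chain_space_\<phi>[OF g x(1)] del_chain_map[OF g x(1)] by (simp add: cycles_eq)
    qed
    show "?s a x \<in> ?Z" for a
      using x chain_space_scale[OF x(1), of a] del_scale[of a x] by (simp add: cycles_eq fun_eq_iff)
    fix y assume "y \<in> ?Z"
    then show "x + y \<in> ?Z" using x by (simp add: cycles_eq chain_space_add del_add)
  qed
  have B: "L.stable ?B"
    unfolding L.stable_def
  proof (intro conjI ballI L.subspaceI)
    show "0 \<in> ?B"
      unfolding boundaries_eq using chain_space_zero
      by (intro image_eqI[of _ _ 0]) (auto simp: del_def fun_eq_iff)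
    fix x assume "x \<in> ?B"
    then obtain c where c: "x = del c" "c \<in> chain_space P leq (i + 1)" by (auto simp: boundaries_eq)
    show "chain_map (\<phi> g) x \<in> ?B" if "g \<in> carrier G" for g
      unfolding boundaries_eq using c chain_space_\<phi>[OF that c(2)] del_chain_map[OF that c(2)] by force
    show "?s a x \<in> ?B" for a
      unfolding boundaries_eq using c chain_space_scale[OF c(2), of a] del_scale[of a c] by force
    fix y assume "y \<in> ?B"
    then obtain d where d: "y = del d" "d \<in> chain_space P leq (i + 1)" by (auto simp: boundaries_eq)
    show "x + y \<in> ?B"
      unfolding boundaries_eq using c d chain_space_add[OF c(2) d(2)] del_add[of c d] by force
  qed
  interpret Q: linear_action_quotient ?s G "\<lambda>g. chain_map (\<phi> g)" ?Z ?B
    by unfold_locales (fact Z, fact B, fact boundaries_subset_cycles[OF char(2)])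
  have eq: "reduced_homology P leq i = quotient_module (L.subspace_module ?Z) ?B"
    by (simp add: reduced_homology_def cycle_module_def L.subspace_module_def zero_fun_def plus_fun_def)
  define \<delta> where "\<delta> \<sigma> = (\<lambda>\<tau>. if \<tau> = \<sigma> then 1 else (0::'f))" for \<sigma> :: "'p set"
  show ?thesis
    unfolding eq
  proof (rule Q.trivial_multiplicity_eq_0)
    show "finite (\<delta> ` OC)" using finite_OC by simp
    show "?Z \<subseteq> L.span (\<delta> ` OC)"
    proof
      fix z assume z: "z \<in> ?Z"
      have "z = (\<Sum>\<sigma>\<in>OC. ?s (z \<sigma>) (\<delta> \<sigma>))"
      proof
        fix \<tau>
        have "(\<Sum>\<sigma>\<in>S. ?s (z \<sigma>) (\<delta> \<sigma>)) \<tau> = (\<Sum>\<sigma>\<in>S. z \<sigma> * \<delta> \<sigma> \<tau>)" for S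
          by (induction S rule: infinite_finite_induct) auto
        then have "(\<Sum>\<sigma>\<in>OC. ?s (z \<sigma>) (\<delta> \<sigma>)) \<tau> = (\<Sum>\<sigma>\<in>OC. z \<sigma> * \<delta> \<sigma> \<tau>)" .
        also have "(\<Sum>\<sigma>\<in>OC. z \<sigma> * \<delta> \<sigma> \<tau>) = z \<tau>"
        proof -
          have "(\<Sum>\<sigma>\<in>OC. z \<sigma> * \<delta> \<sigma> \<tau>) = (\<Sum>\<sigma>\<in>OC. if \<tau> = \<sigma> then z \<sigma> else 0)"
            unfolding \<delta>_def by (intro sum.cong) auto
          also have "\<dots> = (if \<tau> \<in> OC then z \<tau> else 0)" using finite_OC by simp
          finally show ?thesis using z by (auto simp: cycles_eq mem_chain_space)
        qed
        finally show "z \<tau> = (\<Sum>\<sigma>\<in>OC. ?s (z \<sigma>) (\<delta> \<sigma>)) \<tau>" by simp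
      qed
      also have "\<dots> \<in> L.span (\<delta> ` OC)"
        by (intro L.span_sum L.span_scale L.span_base) simp
      finally show "z \<in> L.span (\<delta> ` OC)" .
    qed
    fix z assume z: "z \<in> ?Z" "\<And>g. g \<in> carrier G \<Longrightarrow> chain_map (\<phi> g) z = z"
    have "z (\<phi> g ` \<sigma>) = z \<sigma>" if "g \<in> carrier G" for g \<sigma>
      using z(2)[of "inv g"] chain_map_\<phi>[of "inv g" z] that by (metis inv_closed inv_inv)
    then show "z \<in> ?B" using inv z(1) by (simp add: invariant_def)
  qed
qed

end

section \<open>Cones that are unique up to the stabilizer of a chain\<close>

text \<open>\<open>T\<close> takes values in \<open>K\<close> but is applied to
  \<open>\<sigma> - K\<close>, so inserting or removing a candidate leaves
  \<open>T (\<sigma> - K)\<close> unchanged. Transitivity is required of the pointwise stabilizer,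
  which also fixes any candidate already in \<open>\<sigma>\<close>.\<close>

locale transitive_cones = finite_order_action +
  fixes K :: "'a set" and T :: "'a set \<Rightarrow> 'a set"
  assumes K_P: "K \<subseteq> P"
    and K_invariant: "g \<in> carrier G \<Longrightarrow> x \<in> K \<Longrightarrow> \<phi> g x \<in> K"
    and T_K: "T \<rho> \<subseteq> K"
    and T_invariant: "g \<in> carrier G \<Longrightarrow> \<rho> \<subseteq> P \<Longrightarrow> T (\<phi> g ` \<rho>) = \<phi> g ` T \<rho>"
    and cone_exists: "\<sigma> \<in> OC \<Longrightarrow> \<exists>q\<in>T (\<sigma> - K). insert q \<sigma> \<in> OC"
    and cone_transitive: "\<sigma> \<in> OC \<Longrightarrow> q \<in> T (\<sigma> - K) \<Longrightarrow> insert q \<sigma> \<in> OC \<Longrightarrow>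
      r \<in> T (\<sigma> - K) \<Longrightarrow> insert r \<sigma> \<in> OC \<Longrightarrow>
      \<exists>g\<in>carrier G. (\<forall>x\<in>\<sigma>. \<phi> g x = x) \<and> \<phi> g q = r"
begin

definition E :: "'a set \<Rightarrow> 'a set" where
  "E \<sigma> = {q \<in> T (\<sigma> - K). insert q \<sigma> \<in> OC}"

lemma E_subset_T: "E \<sigma> \<subseteq> T (\<sigma> - K)"
  by (auto simp: E_def)

lemma finite_E: "finite (E \<sigma>)"
  using finite_subset[OF subset_trans[OF E_subset_T subset_trans[OF T_K K_P]] finite_P] .

lemma \<phi>_K_iff: "g \<in> carrier G \<Longrightarrow> \<phi> g x \<in> K \<longleftrightarrow> x \<in> K"
  using K_invariant[of g x] K_invariant[of "inv g" "\<phi> g x"] by (auto simp: \<phi>_inv1)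

lemma \<phi>_image_diff_K: "g \<in> carrier G \<Longrightarrow> \<phi> g ` \<sigma> - K = \<phi> g ` (\<sigma> - K)"
  by (auto simp: \<phi>_K_iff)

lemma T_\<phi>:
  assumes "g \<in> carrier G" "\<sigma> \<subseteq> P"
  shows "T (\<phi> g ` \<sigma> - K) = \<phi> g ` T (\<sigma> - K)"
  using T_invariant[OF assms(1), of "\<sigma> - K"] assms by (auto simp: \<phi>_image_diff_K)

lemma E_\<phi>:
  assumes "g \<in> carrier G" "\<sigma> \<subseteq> P"
  shows "E (\<phi> g ` \<sigma>) = \<phi> g ` E \<sigma>"
  using \<phi>_image_OC[OF assms(1), of "insert _ \<sigma>"] by (auto simp: E_def T_\<phi>[OF assms])

lemma E_transitive:
  assumes "\<sigma> \<in> OC" "q \<in> E \<sigma>" "r \<in> E \<sigma>"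
  shows "\<exists>g\<in>carrier G. (\<forall>x\<in>\<sigma>. \<phi> g x = x) \<and> \<phi> g q = r"
  using cone_transitive[OF assms(1), of q r] assms(2,3) unfolding E_def by blast

text \<open>The pointwise stabilizer fixes \<open>q\<close>, so its orbit, which is all of
  \<open>E \<sigma>\<close>, is a single point. In particular a chain contains at most one
  candidate, and removal is unambiguous.\<close>

lemma E_eq_singleton:
  assumes "\<sigma> \<in> OC" "q \<in> \<sigma>" "q \<in> T (\<sigma> - K)"
  shows "E \<sigma> = {q}"
proof -
  have q: "q \<in> E \<sigma>" using assms by (simp add: E_def insert_absorb)
  have "r = q" if r: "r \<in> E \<sigma>" for r
  proof -
    obtain g where "g \<in> carrier G" "\<And>x. x \<in> \<sigma> \<Longrightarrow> \<phi> g x = x" "\<phi> g q = r"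
      using E_transitive[OF assms(1) q r] by blast
    then show ?thesis using assms(2) by metis
  qed
  then show ?thesis using q by blast
qed

text \<open>Orbit-stabilizer for the pointwise stabilizer \<open>H\<close> of
  \<open>\<sigma>\<close>, followed by Lagrange for \<open>H\<close> in the group. It makes the
  denominators of \<open>cone\<close> invertible.\<close>

lemma card_E_dvd:
  assumes \<sigma>: "\<sigma> \<in> OC"
  shows "card (E \<sigma>) dvd card (carrier G)"
proof -
  define H where "H = {g \<in> carrier G. \<forall>x\<in>\<sigma>. \<phi> g x = x}"
  have "subgroup H G"
  proof
    fix g assume "g \<in> H"
    then have "g \<in> carrier G" "\<phi> (inv g) x = x" if "x \<in> \<sigma>" for x
      using that \<phi>_inv1[of g x] by (auto simp: H_def)
    with \<open>g \<in> H\<close> show "inv g \<in> H" by (simp add: H_def)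
  qed (auto simp: H_def \<phi>_mult \<phi>_one)
  then have dvd: "card H dvd card (carrier G)"
    using lagrange_finite[OF finite_G] unfolding Coset.order_def by (metis dvd_triv_right)
  have H_OC: "\<phi> h q \<in> E \<sigma>" if h: "h \<in> H" and "q \<in> E \<sigma>" for h q
  proof -
    have "\<phi> h ` \<sigma> = \<sigma>" using h by (auto simp: H_def)
    moreover have "\<sigma> \<subseteq> P" using OC_in_P[OF \<sigma>] by blast
    ultimately show ?thesis
      using E_\<phi>[of h \<sigma>] that unfolding H_def by auto
  qed
  obtain q where q: "q \<in> E \<sigma>" using cone_exists[OF \<sigma>] by (auto simp: E_def)
  let ?S = "{h \<in> H. \<phi> h q = q}"
  \<comment> \<open>The fibre over \<open>r\<close> is the left translate of \<open>?S\<close> by an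
    element carrying \<open>q\<close> to \<open>r\<close>.\<close>
  have fib: "card {h \<in> H. \<phi> h q = r} = card ?S" if r: "r \<in> E \<sigma>" for r
  proof -
    obtain g where g: "g \<in> carrier G" "\<And>x. x \<in> \<sigma> \<Longrightarrow> \<phi> g x = x" "\<phi> g q = r"
      using E_transitive[OF \<sigma> q r] by blast
    then have "g \<in> H" by (simp add: H_def)
    then have gH: "g \<in> H" "inv g \<in> H"
      using subgroup.m_inv_closed[OF \<open>subgroup H G\<close>] by auto
    have "bij_betw (\<lambda>h. g \<otimes> h) ?S {h \<in> H. \<phi> h q = r}"
    proof (rule bij_betw_byWitness[where f' = "\<lambda>h. inv g \<otimes> h"])
      show "(\<lambda>h. g \<otimes> h) ` ?S \<subseteq> {h \<in> H. \<phi> h q = r}"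
        using gH g by (auto simp: H_def \<phi>_mult)
      show "(\<lambda>h. inv g \<otimes> h) ` {h \<in> H. \<phi> h q = r} \<subseteq> ?S"
        using gH g \<phi>_inv1 by (auto simp: H_def \<phi>_mult)
    qed (use g in \<open>auto simp: H_def simp flip: m_assoc\<close>)
    then show ?thesis by (simp add: bij_betw_same_card)
  qed
  have "finite H" using finite_G by (simp add: H_def)
  have "card H = card (\<Union>r\<in>E \<sigma>. {h \<in> H. \<phi> h q = r})"
    using H_OC q by (intro arg_cong[where f = card]) auto
  also have "\<dots> = (\<Sum>r\<in>E \<sigma>. card {h \<in> H. \<phi> h q = r})"
    using \<open>finite H\<close> by (intro card_UN_disjoint finite_E) auto
  also have "\<dots> = card (E \<sigma>) * card ?S" using fib by simp
  finally have "card H = card (E \<sigma>) * card ?S" .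
  with dvd show ?thesis using dvd_mult_left by metis
qed

text \<open>
  Since the stabilizer of \<open>\<sigma>\<close> permutes the elements of \<^term>\<open>E \<sigma>\<close> transitively, the simplices
  \<^term>\<open>insert q \<sigma>\<close> with \<^term>\<open>q \<in> E \<sigma>\<close> form a single orbit; \<open>cone\<close> divides by their number.
\<close>

definition cone :: "('a set \<Rightarrow> 'f::field) \<Rightarrow> 'a set \<Rightarrow> 'f" where
  "cone z \<sigma> = (if \<sigma> \<in> OC
     then \<Sum>q\<in>\<sigma> \<inter> T (\<sigma> - K). incidence_sign leq q (\<sigma> - {q}) * z (\<sigma> - {q}) / of_nat (card (E (\<sigma> - {q})))
     else 0)"

lemma cone_nonzeroE:
  assumes "cone z \<sigma> \<noteq> 0"
  obtains q where "\<sigma> \<in> OC" "q \<in> \<sigma>" "q \<in> K" "z (\<sigma> - {q}) \<noteq> 0"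
proof -
  have "\<sigma> \<in> OC" using assms by (auto simp: cone_def split: if_splits)
  have "\<exists>q\<in>\<sigma> \<inter> T (\<sigma> - K). z (\<sigma> - {q}) \<noteq> 0"
  proof (rule ccontr)
    assume "\<not> ?thesis"
    then have "cone z \<sigma> = 0" by (auto simp: cone_def intro!: sum.neutral)
    with assms show False by contradiction
  qed
  then show thesis using that \<open>\<sigma> \<in> OC\<close> T_K by auto
qed

lemma cone_chain_space:
  assumes "z \<in> chain_space P leq i"
  shows "cone z \<in> chain_space P leq (i + 1)"
  unfolding mem_chain_space
proof (intro allI impI)
  fix \<sigma> assume "cone z \<sigma> \<noteq> 0"
  then obtain q where q: "\<sigma> \<in> OC" "q \<in> \<sigma>" "z (\<sigma> - {q}) \<noteq> 0" by (rule cone_nonzeroE)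
  then have "int (card (\<sigma> - {q})) = i + 1" using assms unfolding mem_chain_space by blast
  moreover have "card \<sigma> = Suc (card (\<sigma> - {q}))"
    using card.remove[OF OC_finite[OF q(1)] q(2)] .
  ultimately have "int (card \<sigma>) = i + 1 + 1" by linarith
  then show "\<sigma> \<in> OC \<and> int (card \<sigma>) = i + 1 + 1" using q(1) by blast
qed

text \<open>No choice of a candidate enters \<open>cone\<close>: the index set, the signs and the
  denominators are all transported by \<open>\<phi> g\<close>.\<close>

lemma invariant_cone:
  fixes z :: "'a set \<Rightarrow> 'f::field"
  assumes z: "invariant z"
  shows "invariant (cone z)"
  unfolding invariant_def
proof (intro ballI allI)
  fix g \<sigma> assume g: "g \<in> carrier G"
  show "cone z (\<phi> g ` \<sigma>) = cone z \<sigma>"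
  proof (cases "\<sigma> \<in> OC")
    case False
    then show ?thesis using \<phi>_image_OC[OF g] by (simp add: cone_def)
  next
    case True
    then have P: "\<sigma> \<subseteq> P" using OC_in_P by blast
    let ?f = "\<lambda>\<sigma> q. incidence_sign leq q (\<sigma> - {q}) * z (\<sigma> - {q}) / of_nat (card (E (\<sigma> - {q})))"
    have "\<phi> g ` \<sigma> \<inter> T (\<phi> g ` \<sigma> - K) = \<phi> g ` (\<sigma> \<inter> T (\<sigma> - K))"
      using T_\<phi>[OF g P] inj_\<phi>[OF g] by (simp add: image_Int)
    then have "cone z (\<phi> g ` \<sigma>) = (\<Sum>q\<in>\<phi> g ` (\<sigma> \<inter> T (\<sigma> - K)). ?f (\<phi> g ` \<sigma>) q)"
      using True \<phi>_image_OC[OF g] by (simp add: cone_def)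
    also have "\<dots> = (\<Sum>q\<in>\<sigma> \<inter> T (\<sigma> - K). ?f (\<phi> g ` \<sigma>) (\<phi> g q))"
      by (simp add: sum.reindex inj_on_subset[OF inj_\<phi>[OF g]])
    also have "\<dots> = cone z \<sigma>"
    proof -
      have "?f (\<phi> g ` \<sigma>) (\<phi> g q) = ?f \<sigma> q" if "q \<in> \<sigma>" for q
      proof -
        have "\<phi> g ` \<sigma> - {\<phi> g q} = \<phi> g ` (\<sigma> - {q})"
          using inj_\<phi>[OF g] by (simp add: image_set_diff)
        moreover have qP: "\<sigma> - {q} \<subseteq> P" "q \<in> P" using P that by auto
        moreover have "incidence_sign leq (\<phi> g q) (\<phi> g ` (\<sigma> - {q}))
            = (incidence_sign leq q (\<sigma> - {q}) :: 'f)"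
          by (rule incidence_sign_\<phi>[OF g qP(2,1)])
        ultimately show ?thesis
          using z g by (simp add: invariant_def E_\<phi> card_\<phi>_image)
      qed
      then show ?thesis using True by (simp add: cone_def)
    qed
    finally show ?thesis .
  qed
qed

text \<open>The bound \<open>p\<close> discards all terms that add an element outside
  \<open>K\<close>. If \<open>\<tau>\<close> contains no candidate, only the insertions of members
  of \<open>E \<tau>\<close> remain, each contributing an equal share of \<open>z \<tau>\<close>. If
  it contains a candidate, the cycle condition at the face without it, split evenly among the
  candidates of that face by symmetry, gives the value.\<close>

lemma del_cone:
  fixes z :: "'a set \<Rightarrow> 'f::field"
  assumes z: "z \<in> chain_space P leq i" "del z = 0" "invariant z"
    and p: "\<And>\<sigma>. z \<sigma> \<noteq> 0 \<Longrightarrow> card (\<sigma> - K) \<le> p"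
    and \<tau>: "\<tau> \<in> OC" "card (\<tau> - K) = p"
    and char: "of_nat (card (carrier G)) \<noteq> (0::'f)"
  shows "del (cone z) \<tau> = z \<tau>"
proof -
  have nz: "of_nat (card (E \<sigma>)) \<noteq> (0::'f)" if "\<sigma> \<in> OC" for \<sigma>
    using card_E_dvd[OF that] char by (metis dvd_def mult_zero_left of_nat_mult)
  have fin: "finite \<sigma>" if "\<sigma> \<in> OC" for \<sigma> using OC_finite that by blast
  define sgn :: "'a \<Rightarrow> 'a set \<Rightarrow> 'f" where "sgn = incidence_sign leq"
  define w where "w \<sigma> = (of_nat (card (E \<sigma>)) :: 'f)" for \<sigma>
  define Y where "Y \<sigma> = {y \<in> K - \<sigma>. insert y \<sigma> \<in> OC}" for \<sigma>
  have finY: "finite (Y \<sigma>)" for \<sigma>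
    unfolding Y_def using finite_subset[OF K_P finite_P] by simp
  \<comment> \<open>Such a simplex would have p + 1 elements outside \<open>K\<close>.\<close>
  have z_big: "z (insert y \<sigma>) = 0" if "y \<notin> K" "y \<notin> \<sigma>" "card (\<sigma> - K) = p" for y \<sigma>
  proof (rule ccontr)
    assume nz: "z (insert y \<sigma>) \<noteq> 0"
    then have "insert y \<sigma> \<in> OC" using z(1) unfolding mem_chain_space by blast
    then have "finite \<sigma>" using fin[of "insert y \<sigma>"] by simp
    moreover have "insert y \<sigma> - K = insert y (\<sigma> - K)" using that by auto
    ultimately have "card (insert y \<sigma> - K) = Suc p" using that by simp
    with p[OF nz] show False by simp
  qed
  have YT: "insert y \<sigma> - K = \<sigma> - K" if "y \<in> Y \<sigma>" for y \<sigma>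
    using that by (auto simp: Y_def)
  have sum_Y: "(\<Sum>y\<in>P - \<sigma>. f y) = (\<Sum>y\<in>Y \<sigma>. f y)"
    if "\<And>y. y \<in> P - \<sigma> \<Longrightarrow> y \<notin> Y \<sigma> \<Longrightarrow> f y = 0" for \<sigma> and f :: "'a \<Rightarrow> 'f"
    by (rule sum.mono_neutral_right) (use that K_P finite_P in \<open>auto simp: Y_def\<close>)
  have cone_0: "cone z (insert y \<tau>) = 0" if "y \<in> P - \<tau>" "y \<notin> Y \<tau>" for y
  proof (rule ccontr)
    assume "cone z (insert y \<tau>) \<noteq> 0"
    then obtain q where q: "insert y \<tau> \<in> OC" "q \<in> insert y \<tau>" "q \<in> K" "z (insert y \<tau> - {q}) \<noteq> 0"
      by (rule cone_nonzeroE)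
    then have "y \<notin> K" using that by (auto simp: Y_def)
    then have "insert y \<tau> - {q} = insert y (\<tau> - {q})" using q(3) by auto
    moreover have "\<tau> - {q} - K = \<tau> - K" using q(3) by auto
    ultimately show False using z_big[of y "\<tau> - {q}"] \<open>y \<notin> K\<close> that q(4) \<tau>(2) by auto
  qed
  have del1: "del (cone z) \<tau> = (\<Sum>y\<in>Y \<tau>. sgn y \<tau> * cone z (insert y \<tau>))"
    unfolding del_def sgn_def using cone_0 by (intro sum_Y) auto
  show ?thesis
  proof (cases "\<tau> \<inter> T (\<tau> - K) = {}")
    case True
    have "cone z (insert y \<tau>) = (if y \<in> E \<tau> then sgn y \<tau> * z \<tau> / w \<tau> else 0)" if y: "y \<in> Y \<tau>" for y
    proof -
      \<comment> \<open>Since \<open>y\<close> is in \<open>K\<close>, the argument of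
        \<open>T\<close> is still \<open>\<tau> - K\<close>; so the only candidate that can occur is
        \<open>y\<close> itself.\<close>
      have "insert y \<tau> \<inter> T (insert y \<tau> - K) = (if y \<in> E \<tau> then {y} else {})"
        using y True unfolding YT[OF y] by (auto simp: E_def Y_def)
      moreover have "insert y \<tau> - {y} = \<tau>" using y by (auto simp: Y_def)
      ultimately show ?thesis using y by (simp add: cone_def Y_def sgn_def w_def)
    qed
    then have "del (cone z) \<tau> = (\<Sum>y\<in>Y \<tau>. if y \<in> E \<tau> then z \<tau> / w \<tau> else 0)"
      unfolding del1 using incidence_sign_square[of leq _ \<tau>, where 'a = 'f]
      by (intro sum.cong) (auto simp: sgn_def simp flip: mult.assoc)
    also have "\<dots> = (\<Sum>y\<in>Y \<tau> \<inter> E \<tau>. z \<tau> / w \<tau>)"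
      by (rule sum.inter_restrict[OF finY, symmetric])
    also have "Y \<tau> \<inter> E \<tau> = E \<tau>"
      using True T_K by (auto simp: Y_def E_def)
    finally show ?thesis using nz[OF \<tau>(1)] by (simp add: w_def)
  next
    case False
    then obtain q where q: "q \<in> \<tau>" "q \<in> T (\<tau> - K)" by blast
    have qK: "q \<in> K" using q T_K by blast
    have E\<tau>: "E \<tau> = {q}" by (rule E_eq_singleton[OF \<tau>(1) q])
    define \<sigma> where "\<sigma> = \<tau> - {q}"
    have \<sigma>: "\<sigma> \<in> OC" "q \<notin> \<sigma>" "\<tau> = insert q \<sigma>" "\<sigma> - K = \<tau> - K"
      using OC_subset[OF \<tau>(1)] q qK by (auto simp: \<sigma>_def)
    have qE: "q \<in> E \<sigma>" using q \<sigma> \<tau>(1) by (simp add: E_def)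
    \<comment> \<open>The term of \<open>y\<close> in \<open>del z \<sigma>\<close>, divided into
      equal shares for the candidates of \<open>insert y \<sigma>\<close>.\<close>
    define F where "F y = sgn y \<sigma> * z (insert y \<sigma>) / w (insert y \<sigma>)" for y
    have c1: "cone z (insert y \<tau>) = sgn q (insert y \<sigma>) * z (insert y \<sigma>) / w (insert y \<sigma>)"
      if y: "y \<in> Y \<tau>" for y
    proof -
      have "x \<in> E \<tau>" if "x \<in> insert y \<tau> \<inter> T (insert y \<tau> - K)" for x
        using that y \<tau>(1) unfolding YT[OF y] by (auto simp: E_def Y_def insert_absorb)
      then have "insert y \<tau> \<inter> T (insert y \<tau> - K) = {q}"
        using q unfolding YT[OF y] E\<tau> by blast
      moreover have "insert y \<tau> - {q} = insert y \<sigma>" using y q(1) by (auto simp: Y_def \<sigma>_def)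
      ultimately show ?thesis using y by (simp add: cone_def Y_def sgn_def w_def)
    qed
    \<comment> \<open>Adding \<open>q\<close> and \<open>y\<close> to \<open>\<sigma>\<close> in the
      two orders gives opposite signs; the signs relative to \<open>\<sigma>\<close> are collected
      on the right.\<close>
    have c2: "sgn y \<tau> * sgn q (insert y \<sigma>) = - (sgn q \<sigma> * sgn y \<sigma>)" if y: "y \<in> Y \<tau>" for y
    proof -
      have yq: "y \<noteq> q" "y \<notin> \<sigma>" using y q \<sigma> by (auto simp: Y_def)
      have "leq q y \<longleftrightarrow> \<not> leq y q"
        by (rule OC_total[of "insert y \<tau>"]) (use y q yq in \<open>auto simp: Y_def\<close>)
      then show ?thesis
        using fin[OF \<sigma>(1)] \<sigma>(2) yq by (auto simp: sgn_def \<sigma>(3) incidence_sign_insert)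
    qed
    have "sgn y \<tau> * cone z (insert y \<tau>) = - (sgn q \<sigma> * F y)" if y: "y \<in> Y \<tau>" for y
    proof -
      have "sgn y \<tau> * cone z (insert y \<tau>)
          = sgn y \<tau> * sgn q (insert y \<sigma>) * z (insert y \<sigma>) / w (insert y \<sigma>)"
        by (simp add: c1[OF y])
      then show ?thesis unfolding c2[OF y] by (simp add: F_def)
    qed
    then have del2: "del (cone z) \<tau> = - (sgn q \<sigma> * (\<Sum>y\<in>Y \<tau>. F y))"
      by (simp add: del1 sum_negf sum_distrib_left)
    \<comment> \<open>All shares that fall to the candidate \<open>r\<close> of
      \<open>\<sigma>\<close>.\<close>
    define S where "S r = (\<Sum>y\<in>{y \<in> Y \<sigma>. r \<in> E (insert y \<sigma>)}. F y)" for r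
    \<comment> \<open>A group element fixing \<open>\<sigma>\<close> pointwise and taking
      \<open>q\<close> to \<open>r\<close> permutes the vertices that can be added, and preserves
      \<open>F\<close> because \<open>z\<close> is invariant.\<close>
    have S_eq: "S r = S q" if r: "r \<in> E \<sigma>" for r
    proof -
      obtain g where g: "g \<in> carrier G" "\<And>x. x \<in> \<sigma> \<Longrightarrow> \<phi> g x = x" "\<phi> g q = r"
        using E_transitive[OF \<sigma>(1) qE r] by blast
      have g\<sigma>: "\<phi> g ` \<sigma> = \<sigma>" using g(2) by auto
      have ins: "insert (\<phi> g y) \<sigma> = \<phi> g ` insert y \<sigma>" for y using g\<sigma> by simp
      have \<sigma>P: "\<sigma> \<subseteq> P" using OC_in_P[OF \<sigma>(1)] by blast
      have Yg: "\<phi> g y \<in> Y \<sigma> \<longleftrightarrow> y \<in> Y \<sigma>" for y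
        unfolding Y_def mem_Collect_eq Diff_iff ins \<phi>_image_OC[OF g(1)] \<phi>_K_iff[OF g(1)]
        using g\<sigma> inj_\<phi>[OF g(1)] by (metis inj_image_mem_iff)
      have Eg: "\<phi> g x \<in> E (insert (\<phi> g y) \<sigma>) \<longleftrightarrow> x \<in> E (insert y \<sigma>)" if "y \<in> Y \<sigma>" for x y
        unfolding ins using that \<sigma>P K_P inj_\<phi>[OF g(1)]
        by (subst E_\<phi>[OF g(1)]) (auto simp: Y_def inj_image_mem_iff)
      have img: "{y \<in> Y \<sigma>. r \<in> E (insert y \<sigma>)} = \<phi> g ` {y \<in> Y \<sigma>. q \<in> E (insert y \<sigma>)}"
      proof (intro Set.set_eqI iffI)
        fix y assume y: "y \<in> {y \<in> Y \<sigma>. r \<in> E (insert y \<sigma>)}"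
        have y': "y = \<phi> g (\<phi> (inv g) y)" using g by (simp add: \<phi>_inv2)
        then have "\<phi> (inv g) y \<in> {y \<in> Y \<sigma>. q \<in> E (insert y \<sigma>)}"
          using y Yg Eg g(3) by (metis (no_types, lifting) mem_Collect_eq)
        with y' show "y \<in> \<phi> g ` {y \<in> Y \<sigma>. q \<in> E (insert y \<sigma>)}" by blast
      qed (use Yg Eg g(3) in auto)
      have "F (\<phi> g y) = F y" if "y \<in> Y \<sigma>" for y
      proof -
        have "y \<in> P" "insert y \<sigma> \<subseteq> P" using that K_P \<sigma>P by (auto simp: Y_def)
        moreover have "sgn (\<phi> g y) \<sigma> = sgn y \<sigma>"
          unfolding sgn_def by (subst g\<sigma>[symmetric]) (rule incidence_sign_\<phi>[OF g(1) \<open>y \<in> P\<close> \<sigma>P])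
        moreover have "z (insert (\<phi> g y) \<sigma>) = z (insert y \<sigma>)"
          unfolding ins using z(3) g(1) unfolding invariant_def by blast
        moreover have "w (insert (\<phi> g y) \<sigma>) = w (insert y \<sigma>)"
          unfolding ins w_def using E_\<phi>[OF g(1)] \<open>insert y \<sigma> \<subseteq> P\<close> card_\<phi>_image[OF g(1)] by (simp del: image_insert)
        ultimately show ?thesis by (simp add: F_def)
      qed
      then show ?thesis
        unfolding S_def img
        by (subst sum.reindex[OF inj_on_subset[OF inj_\<phi>[OF g(1)]]]) auto
    qed
    \<comment> \<open>Candidates of \<open>insert y \<sigma>\<close> are candidates of
      \<open>\<sigma>\<close>, so the cycle condition regroups into a sum of the equal numbers
      \<open>S r\<close>, each of which must vanish.\<close>
    have "0 = del z \<sigma>" using z(2) by simp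
    also have "\<dots> = (\<Sum>y\<in>Y \<sigma>. sgn y \<sigma> * z (insert y \<sigma>))"
      unfolding del_def sgn_def
    proof (rule sum_Y)
      fix y assume y: "y \<in> P - \<sigma>" "y \<notin> Y \<sigma>"
      have "z (insert y \<sigma>) = 0"
      proof (cases "y \<in> K")
        case True
        then have "insert y \<sigma> \<notin> OC" using y by (auto simp: Y_def)
        then show ?thesis using z(1) unfolding mem_chain_space by blast
      qed (use y z_big \<sigma>(4) \<tau>(2) in auto)
      then show "incidence_sign leq y \<sigma> * z (insert y \<sigma>) = 0" by simp
    qed
    also have "\<dots> = (\<Sum>y\<in>Y \<sigma>. \<Sum>r\<in>{r \<in> E \<sigma>. r \<in> E (insert y \<sigma>)}. F y)"
    proof (rule sum.cong[OF refl])
      fix y assume y: "y \<in> Y \<sigma>"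
      have "r \<in> E \<sigma>" if r: "r \<in> E (insert y \<sigma>)" for r
        using r OC_subset[of "insert r (insert y \<sigma>)" "insert r \<sigma>"] YT[OF y] by (auto simp: E_def)
      then have "{r \<in> E \<sigma>. r \<in> E (insert y \<sigma>)} = E (insert y \<sigma>)" by blast
      moreover have "w (insert y \<sigma>) \<noteq> 0" using nz y by (simp add: w_def Y_def)
      ultimately show "sgn y \<sigma> * z (insert y \<sigma>) = (\<Sum>r\<in>{r \<in> E \<sigma>. r \<in> E (insert y \<sigma>)}. F y)"
        by (simp add: F_def w_def)
    qed
    also have "\<dots> = (\<Sum>r\<in>E \<sigma>. S r)"
      unfolding S_def by (rule sum.swap_restrict[OF finY finite_E])
    also have "\<dots> = w \<sigma> * S q" using S_eq by (simp add: w_def)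
    finally have "S q = 0" using nz[OF \<sigma>(1)] by (simp add: w_def)
    \<comment> \<open>The share of \<open>q\<close> consists of the terms of
      \<open>del (cone z) \<tau>\<close>, up to a common sign, and one further term
      \<open>y = q\<close>. As \<open>E \<tau>\<close> is a singleton, that term is
      \<open>z \<tau>\<close> up to sign.\<close>
    have "{y \<in> Y \<sigma>. q \<in> E (insert y \<sigma>)} = insert q (Y \<tau>)"
    proof (intro Set.set_eqI iffI)
      fix y assume "y \<in> {y \<in> Y \<sigma>. q \<in> E (insert y \<sigma>)}"
      then show "y \<in> insert q (Y \<tau>)"
        by (auto simp: Y_def E_def \<sigma>(3) insert_commute)
    next
      fix y assume y: "y \<in> insert q (Y \<tau>)"
      show "y \<in> {y \<in> Y \<sigma>. q \<in> E (insert y \<sigma>)}"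
      proof (cases "y = q")
        case True
        then show ?thesis using qK \<sigma> \<tau>(1) E\<tau> by (auto simp: Y_def)
      next
        case False
        then have yY: "y \<in> Y \<tau>" using y by simp
        then have "insert q (insert y \<sigma>) \<in> OC" by (simp add: Y_def \<sigma>(3) insert_commute)
        moreover then have "insert y \<sigma> \<in> OC" using OC_subset by blast
        ultimately show ?thesis
          using yY False q \<sigma> YT[of y \<sigma>] by (auto simp: Y_def E_def)
      qed
    qed
    moreover have "q \<notin> Y \<tau>" using q by (simp add: Y_def)
    ultimately have "F q + (\<Sum>y\<in>Y \<tau>. F y) = 0"
      using \<open>S q = 0\<close> finY by (simp add: S_def)
    moreover have "F q = sgn q \<sigma> * z \<tau>" by (simp add: F_def w_def E\<tau> flip: \<sigma>(3))
    ultimately have "(\<Sum>y\<in>Y \<tau>. F y) = - (sgn q \<sigma> * z \<tau>)"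
      by (simp add: eq_neg_iff_add_eq_0 add.commute)
    then show ?thesis
      using incidence_sign_square[of leq q \<sigma>, where 'a = 'f] unfolding del2 sgn_def
      by (simp flip: mult.assoc)
  qed
qed

text \<open>Since \<open>cone\<close> inserts only elements of \<open>K\<close> and
  \<open>del\<close> removes vertices, the correction never raises the number of elements outside
  \<open>K\<close>, while \<open>del_cone\<close> cancels the top layer. Hence the induction on a
  bound \<open>p\<close> for this number.\<close>

theorem invariant_cycle_is_boundary:
  fixes z :: "'a set \<Rightarrow> 'f::field"
  assumes "z \<in> cycles P leq i" "invariant z"
    and char: "of_nat (card (carrier G)) \<noteq> (0::'f)" "(2::'f) \<noteq> 0"
  shows "z \<in> boundaries P leq i"
proof -
  have "z \<in> boundaries P leq i"
    if "z \<in> cycles P leq i" "invariant z" "\<And>\<sigma>. z \<sigma> \<noteq> 0 \<Longrightarrow> card (\<sigma> - K) < p"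
    for p and z :: "'a set \<Rightarrow> 'f"
    using that
  proof (induction p arbitrary: z)
    case 0
    \<comment> \<open>The bound is strict, so 0 excludes even the empty simplex from the
      support.\<close>
    then have "z = del 0" by (auto simp: fun_eq_iff del_def)
    then show ?case unfolding boundaries_eq using chain_space_zero by blast
  next
    case (Suc p)
    have z: "z \<in> chain_space P leq i" "del z = 0" using Suc.prems(1) by (auto simp: cycles_eq)
    have cz: "cone z \<in> chain_space P leq (i + 1)" by (rule cone_chain_space[OF z(1)])
    have dz: "del (cone z) \<in> chain_space P leq i" by (rule del_chain_space[OF cz])
    define z' where "z' = z - del (cone z)"
    have "z' \<in> chain_space P leq i"
      unfolding z'_def by (rule chain_space_diff[OF z(1) dz])
    moreover have "del z' = 0"
      using z(2) del_del[OF cz char(2)] by (simp add: z'_def del_diff)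
    ultimately have "z' \<in> cycles P leq i" by (simp add: cycles_eq)
    moreover have "invariant (del (cone z))"
      by (intro invariant_del invariant_cone Suc.prems(2))
        (use cz in \<open>auto simp: mem_chain_space dest: OC_in_P\<close>)
    then have "invariant z'"
      using Suc.prems(2) by (simp add: invariant_def z'_def)
    moreover have "card (\<sigma> - K) < p" if nz: "z' \<sigma> \<noteq> 0" for \<sigma>
    proof -
      have \<sigma>: "\<sigma> \<in> OC" using nz \<open>z' \<in> chain_space P leq i\<close> by (simp add: mem_chain_space)
      have "card (\<sigma> - K) \<le> p"
      proof (cases "z \<sigma> = 0")
        case False
        then show ?thesis using Suc.prems(3) by fastforce
      next
        case True
        then have "del (cone z) \<sigma> \<noteq> 0" using nz by (simp add: z'_def)
        then obtain y where y: "y \<in> P - \<sigma>" "cone z (insert y \<sigma>) \<noteq> 0" by (rule del_nonzeroE)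
        then obtain q where q: "insert y \<sigma> \<in> OC" "q \<in> K" "z (insert y \<sigma> - {q}) \<noteq> 0"
          by (elim cone_nonzeroE)
        have "card (\<sigma> - K) \<le> card (insert y \<sigma> - {q} - K)"
          using OC_finite[OF q(1)] q(2) by (intro card_mono) auto
        also have "\<dots> < Suc p" by (rule Suc.prems(3)[OF q(3)])
        finally show ?thesis by simp
      qed
      moreover have "card (\<sigma> - K) \<noteq> p"
      proof
        assume "card (\<sigma> - K) = p"
        then have "del (cone z) \<sigma> = z \<sigma>"
          using del_cone[OF z Suc.prems(2) _ \<sigma> _ char(1)] Suc.prems(3) less_Suc_eq_le by blast
        then show False using nz by (simp add: z'_def)
      qed
      ultimately show ?thesis by simp
    qed
    ultimately have "z' \<in> boundaries P leq i" by (rule Suc.IH)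
    then obtain c where c: "c \<in> chain_space P leq (i + 1)" "z' = del c" by (auto simp: boundaries_eq)
    have "z = del (c + cone z)" using c(2) by (simp add: z'_def del_add algebra_simps)
    moreover have "c + cone z \<in> chain_space P leq (i + 1)"
      by (rule chain_space_add[OF c(1) cz])
    ultimately show ?case unfolding boundaries_eq by blast
  qed
  moreover have "card (\<sigma> - K) < Suc (card P)" if "z \<sigma> \<noteq> 0" for \<sigma>
  proof -
    have "\<sigma> \<subseteq> P" using assms(1) that by (auto simp: cycles_eq mem_chain_space dest: OC_in_P)
    then have "\<sigma> - K \<subseteq> P" by blast
    then show ?thesis by (intro le_imp_less_Suc card_mono[OF finite_P])
  qed
  ultimately show ?thesis using assms(1,2) by blast
qed

end

section \<open>Families of disjoint blocks of equal size\<close>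

text \<open>Bijections between corresponding fibres are glued to one that preserves labels. It
  serves twice below: for matching blocks and for matching points.\<close>

lemma fibrewise_bij_betw:
  assumes "finite A" "finite B" and card: "\<And>y. card {x \<in> A. f x = y} = card {x \<in> B. g x = y}"
  shows "\<exists>\<beta>. bij_betw \<beta> A B \<and> (\<forall>x\<in>A. g (\<beta> x) = f x)"
proof -
  have "\<forall>y. \<exists>h. bij_betw h {x \<in> A. f x = y} {x \<in> B. g x = y}"
    using assms by (intro allI finite_same_card_bij) auto
  then obtain h where h: "\<And>y. bij_betw (h y) {x \<in> A. f x = y} {x \<in> B. g x = y}" by metis
  define \<beta> where "\<beta> x = h (f x) x" for x
  have \<beta>: "\<beta> x \<in> B" "g (\<beta> x) = f x" if "x \<in> A" for x
    using bij_betw_apply[OF h, of x "f x"] that by (auto simp: \<beta>_def)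
  have "inj_on \<beta> A"
  proof (rule inj_onI)
    fix x y assume xy: "x \<in> A" "y \<in> A" "\<beta> x = \<beta> y"
    then have "f x = f y" using \<beta> by metis
    then show "x = y"
      using xy bij_betw_imp_inj_on[OF h[of "f x"]] by (auto simp: \<beta>_def inj_on_def)
  qed
  moreover have "y \<in> \<beta> ` A" if "y \<in> B" for y
  proof -
    have "y \<in> h (g y) ` {x \<in> A. f x = g y}"
      using bij_betw_imp_surj_on[OF h[of "g y"]] that by simp
    then obtain x where "x \<in> A" "f x = g y" "y = h (g y) x" by blast
    then have "y = \<beta> x" by (simp add: \<beta>_def)
    with \<open>x \<in> A\<close> show ?thesis by blast
  qed
  ultimately show ?thesis using \<beta> by (auto simp: bij_betw_def)
qed

text \<open>Models the blocks of size k of a partition whose other blocks are singletons.\<close>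

definition block_family :: "'a set \<Rightarrow> nat \<Rightarrow> 'a set set \<Rightarrow> bool" where
  "block_family A k F \<longleftrightarrow> disjoint F \<and> (\<forall>C\<in>F. C \<subseteq> A \<and> card C = k)"

text \<open>This is refinement once the remaining points are added to \<open>F\<close> as
  singletons, because a singleton lies in a block of any partition.\<close>

definition inside :: "'a set set \<Rightarrow> 'a set set \<Rightarrow> bool" where
  "inside F b \<longleftrightarrow> (\<forall>C\<in>F. \<exists>B\<in>b. C \<subseteq> B)"

lemma block_family_subset: "block_family A k F \<Longrightarrow> H \<subseteq> F \<Longrightarrow> block_family A k H"
  by (auto simp: block_family_def intro: pairwise_subset)

lemma finite_block_family: "finite A \<Longrightarrow> block_family A k F \<Longrightarrow> finite F"
  by (rule finite_subset[of _ "Pow A"]) (auto simp: block_family_def)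

lemma block_family_disjoint:
  "block_family A k F \<Longrightarrow> C \<in> F \<Longrightarrow> D \<in> F \<Longrightarrow> x \<in> C \<Longrightarrow> x \<in> D \<Longrightarrow> C = D"
  by (auto simp: block_family_def disjoint_def)

lemma card_Union_block_family:
  assumes "finite A" "block_family A k F"
  shows "card (\<Union>F) = k * card F"
proof -
  have "finite (\<Union>F)"
    by (rule finite_subset[OF _ assms(1)]) (use assms(2) in \<open>auto simp: block_family_def\<close>)
  then have "k * card F = card (\<Union>F)"
    using finite_block_family[OF assms] assms(2)
    by (intro card_partition) (auto simp: block_family_def disjoint_def)
  then show ?thesis by simp
qed

lemma block_family_exists:
  assumes "finite S" "k * j \<le> card S" "0 < k"
  shows "\<exists>H. block_family S k H \<and> card H = j"
  using assms(2)
proof (induction j)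
  case 0
  then show ?case by (intro exI[of _ "{}"]) (auto simp: block_family_def)
next
  case (Suc j)
  then obtain H where H: "block_family S k H" "card H = j" by auto
  have finH: "finite H" by (rule finite_block_family[OF assms(1) H(1)])
  have "\<Union>H \<subseteq> S" using H(1) by (auto simp: block_family_def)
  then have "card (S - \<Union>H) = card S - k * j"
    using card_Union_block_family[OF assms(1) H(1)] H(2) finite_subset[OF _ assms(1)]
    by (simp add: card_Diff_subset)
  then have "k \<le> card (S - \<Union>H)" using Suc.prems by simp
  then obtain C where C: "C \<subseteq> S - \<Union>H" "card C = k" "finite C"
    using obtain_subset_with_card_n by metis
  have "C \<noteq> {}" using C assms(3) by auto
  then have "C \<notin> H" using C by auto
  moreover have "block_family S k (insert C H)"
    using H(1) C by (auto simp: block_family_def pairwise_insert disjnt_def)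
  ultimately show ?case using H finH by (intro exI[of _ "insert C H"]) simp
qed

lemma partition_on_same_block:
  assumes "partition_on A b" "B \<in> b" "B' \<in> b" "x \<in> B" "x \<in> B'"
  shows "B = B'"
  using assms by (auto simp: partition_on_def disjoint_def)

lemma inside_block_unique:
  assumes b: "partition_on A b" "B \<in> b" "B' \<in> b" and C: "C \<subseteq> B" "C \<subseteq> B'" "C \<noteq> {}"
  shows "B = B'"
proof -
  obtain x where "x \<in> C" using C(3) by blast
  then show ?thesis using partition_on_same_block[OF b] C by blast
qed

lemma block_family_nonempty:
  "block_family A k F \<Longrightarrow> 0 < k \<Longrightarrow> C \<in> F \<Longrightarrow> C \<noteq> {}"
  by (auto simp: block_family_def)

lemma card_inside_eq_sum:
  assumes A: "finite A" and b: "partition_on A b" and F: "block_family A k F" "inside F b" and k: "0 < k"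
  shows "card F = (\<Sum>B\<in>b. card {C \<in> F. C \<subseteq> B})"
proof -
  have "F = (\<Union>B\<in>b. {C \<in> F. C \<subseteq> B})" using F(2) by (auto simp: inside_def)
  then have "card F = card (\<Union>B\<in>b. {C \<in> F. C \<subseteq> B})" by simp
  also have "\<dots> = (\<Sum>B\<in>b. card {C \<in> F. C \<subseteq> B})"
  proof (rule card_UN_disjoint)
    show "finite b" by (rule finite_elements[OF A b])
    show "\<forall>B\<in>b. finite {C \<in> F. C \<subseteq> B}" using finite_block_family[OF A F(1)] by simp
    show "\<forall>B\<in>b. \<forall>B'\<in>b. B \<noteq> B' \<longrightarrow> {C \<in> F. C \<subseteq> B} \<inter> {C \<in> F. C \<subseteq> B'} = {}"
      using inside_block_unique[OF b] block_family_nonempty[OF F(1) k] by blast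
  qed
  finally show ?thesis .
qed

lemma card_inside_le:
  assumes A: "finite A" and b: "partition_on A b" and F: "block_family A k F" and "B \<in> b"
  shows "k * card {C \<in> F. C \<subseteq> B} \<le> card B"
proof -
  have "B \<subseteq> A" using b \<open>B \<in> b\<close> by (auto simp: partition_on_def)
  have "k * card {C \<in> F. C \<subseteq> B} = card (\<Union>{C \<in> F. C \<subseteq> B})"
    using card_Union_block_family[OF A block_family_subset[OF F]] by simp
  also have "\<dots> \<le> card B"
    using finite_subset[OF \<open>B \<subseteq> A\<close> A] by (intro card_mono) auto
  finally show ?thesis .
qed

lemma card_Diff_Union_family:
  assumes A: "finite A" and b: "partition_on A b" and F: "block_family A k F" and "B \<in> b"
  shows "card (B - \<Union>{C \<in> F. C \<subseteq> B}) = card B - k * card {C \<in> F. C \<subseteq> B}"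
proof -
  have "B \<subseteq> A" using b \<open>B \<in> b\<close> by (auto simp: partition_on_def)
  then have "finite B" using A finite_subset by blast
  have "card (\<Union>{C \<in> F. C \<subseteq> B}) = k * card {C \<in> F. C \<subseteq> B}"
    using card_Union_block_family[OF A block_family_subset[OF F]] by simp
  moreover have "\<Union>{C \<in> F. C \<subseteq> B} \<subseteq> B" by blast
  ultimately show ?thesis
    using card_Diff_subset[of "\<Union>{C \<in> F. C \<subseteq> B}" B] finite_subset[OF _ \<open>finite B\<close>] by simp
qed

text \<open>Each block of \<open>b\<close> is filled separately: enough of its points are uncovered
  by \<open>card_Diff_Union_family\<close>, and sets chosen in different blocks of \<open>b\<close>
  cannot meet.\<close>

lemma block_family_extend:
  assumes A: "finite A" and b: "partition_on A b" and k: "0 < k"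
    and F: "block_family A k F" "inside F b"
    and m: "\<And>B. B \<in> b \<Longrightarrow> k * m B \<le> card B"
    and Fm: "\<And>B. B \<in> b \<Longrightarrow> card {C \<in> F. C \<subseteq> B} \<le> m B"
  shows "\<exists>H. block_family A k H \<and> inside H b \<and> F \<subseteq> H \<and> (\<forall>B\<in>b. card {C \<in> H. C \<subseteq> B} = m B)"
proof -
  have BA: "B \<subseteq> A" if "B \<in> b" for B using b that by (auto simp: partition_on_def)
  let ?S = "\<lambda>B. B - \<Union>{C \<in> F. C \<subseteq> B}"
  let ?j = "\<lambda>B. m B - card {C \<in> F. C \<subseteq> B}"
  have "\<exists>H. block_family (?S B) k H \<and> card H = ?j B" if B: "B \<in> b" for B
  proof (rule block_family_exists[OF _ _ k])
    show "finite (?S B)" using finite_subset[OF BA[OF B] A] by simp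
    show "k * ?j B \<le> card (?S B)"
      using card_Diff_Union_family[OF A b F(1) B] m[OF B] by (simp add: diff_mult_distrib2 diff_le_mono)
  qed
  then have "\<exists>H. \<forall>B\<in>b. block_family (?S B) k (H B) \<and> card (H B) = ?j B"
    by (intro bchoice ballI)
  then obtain H where "\<forall>B\<in>b. block_family (?S B) k (H B) \<and> card (H B) = ?j B" ..
  then have H: "\<And>B. B \<in> b \<Longrightarrow> block_family (?S B) k (H B)"
    "\<And>B. B \<in> b \<Longrightarrow> card (H B) = ?j B" by simp_all
  have HB: "C \<subseteq> B" "C \<noteq> {}" "card C = k" "x \<in> C \<Longrightarrow> D \<in> F \<Longrightarrow> x \<notin> D"
    if "B \<in> b" "C \<in> H B" for B C x D
  proof -
    show "C \<subseteq> B" "card C = k" using H(1)[OF that(1)] that(2) by (auto simp: block_family_def)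
    then show "C \<noteq> {}" using k by auto
    show "x \<notin> D" if x: "x \<in> C" "D \<in> F"
    proof
      assume "x \<in> D"
      obtain B' where B': "B' \<in> b" "D \<subseteq> B'" using F(2) x(2) by (auto simp: inside_def)
      then have "B' = B"
        using partition_on_same_block[OF b B'(1) \<open>B \<in> b\<close>] \<open>x \<in> D\<close> \<open>x \<in> C\<close> \<open>C \<subseteq> B\<close> by blast
      then show False
        using H(1)[OF \<open>B \<in> b\<close>] \<open>C \<in> H B\<close> x B'(2) \<open>x \<in> D\<close> by (auto simp: block_family_def)
    qed
  qed
  define F' where "F' = F \<union> (\<Union>B\<in>b. H B)"
  have "disjoint F'"
  proof (rule pairwiseI)
    fix C D assume CD: "C \<in> F'" "D \<in> F'" "C \<noteq> D"
    have "C = D" if x: "x \<in> C" "x \<in> D" for x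
    proof -
      consider "C \<in> F" "D \<in> F" | B where "B \<in> b" "C \<in> H B" "D \<in> F" | B where "B \<in> b" "D \<in> H B" "C \<in> F"
        | B B' where "B \<in> b" "C \<in> H B" "B' \<in> b" "D \<in> H B'"
        using CD by (auto simp: F'_def)
      then show ?thesis
      proof cases
        case 1
        then show ?thesis using block_family_disjoint[OF F(1)] x by blast
      next
        case 2
        then show ?thesis using HB(4)[OF 2(1,2) x(1) 2(3)] x(2) by simp
      next
        case 3
        then show ?thesis using HB(4)[OF 3(1,2) x(2) 3(3)] x(1) by simp
      next
        case 4
        then have "B = B'" using partition_on_same_block[OF b] HB(1) x by blast
        then show ?thesis using block_family_disjoint[OF H(1)] 4 x by blast
      qed
    qed
    then show "disjnt C D" using CD(3) by (auto simp: disjnt_def)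
  qed
  moreover have "C \<subseteq> A \<and> card C = k" if C: "C \<in> F'" for C
  proof (cases "C \<in> F")
    case True
    then show ?thesis using F(1) by (simp add: block_family_def)
  next
    case False
    then obtain B where "B \<in> b" "C \<in> H B" using C by (auto simp: F'_def)
    then show ?thesis using HB(1,3) BA by (meson order_trans)
  qed
  ultimately have fam: "block_family A k F'" by (simp add: block_family_def)
  have ins: "inside F' b"
    unfolding inside_def
  proof
    fix C assume "C \<in> F'"
    then consider "C \<in> F" | B where "B \<in> b" "C \<in> H B" by (auto simp: F'_def)
    then show "\<exists>B\<in>b. C \<subseteq> B"
    proof cases
      case 1
      then show ?thesis using F(2) by (simp add: inside_def)
    next
      case 2
      then show ?thesis using HB(1) by blast
    qed
  qed
  have "card {C \<in> F'. C \<subseteq> B} = m B" if B: "B \<in> b" for B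
  proof -
    have "{C \<in> F'. C \<subseteq> B} = {C \<in> F. C \<subseteq> B} \<union> H B"
    proof (intro Set.set_eqI iffI)
      fix C assume C: "C \<in> {C \<in> F'. C \<subseteq> B}"
      then consider "C \<in> F" | B' where "B' \<in> b" "C \<in> H B'" by (auto simp: F'_def)
      then show "C \<in> {C \<in> F. C \<subseteq> B} \<union> H B"
      proof cases
        case 2
        then have "B' = B" using inside_block_unique[OF b 2(1) B HB(1)[OF 2]] C HB(2)[OF 2] by simp
        then show ?thesis using 2 by simp
      qed (use C in simp)
    next
      fix C assume "C \<in> {C \<in> F. C \<subseteq> B} \<union> H B"
      then show "C \<in> {C \<in> F'. C \<subseteq> B}"
        using HB(1)[OF B] B by (auto simp: F'_def)
    qed
    moreover have "C \<notin> F" if "C \<in> H B" for C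
      using HB(2)[OF B that] HB(4)[OF B that] by blast
    then have "{C \<in> F. C \<subseteq> B} \<inter> H B = {}" by blast
    moreover have "finite (H B)" using finite_block_family[OF _ H(1)[OF B]] finite_subset[OF BA[OF B] A] by simp
    moreover have "finite F" by (rule finite_block_family[OF A F(1)])
    ultimately show ?thesis using H(2)[OF B] Fm[OF B] by (simp add: card_Un_disjoint)
  qed
  with fam ins show ?thesis by (intro exI[of _ F']) (auto simp: F'_def)
qed

text \<open>Two matchings produce \<open>g\<close>. One pairs the members of \<open>F1\<close> and
  \<open>F2\<close> within each block of \<open>b\<close> and keeps those of \<open>F\<close>; the
  other pairs points, following the matched members and keeping uncovered points in their block of
  \<open>b\<close>. Equal counts in each block make the label classes equally large.\<close>

lemma block_family_transitive:
  assumes A: "finite A" and b: "partition_on A b" and k: "0 < k"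
    and F1: "block_family A k F1" "inside F1 b" and F2: "block_family A k F2" "inside F2 b"
    and F: "F \<subseteq> F1" "F \<subseteq> F2"
    and eq: "\<And>B. B \<in> b \<Longrightarrow> card {C \<in> F1. C \<subseteq> B} = card {C \<in> F2. C \<subseteq> B}"
  shows "\<exists>g. g permutes A \<and> (\<forall>B\<in>b. g ` B = B) \<and> (\<forall>C\<in>F. g ` C = C) \<and> (`) g ` F1 = F2"
proof -
  have BA: "B \<subseteq> A" if "B \<in> b" for B using b that by (auto simp: partition_on_def)
  have finB: "finite B" if "B \<in> b" for B using finite_subset[OF BA[OF that] A] .
  have fin: "finite F1" "finite F2" using finite_block_family A F1 F2 by blast+
  have "\<forall>x\<in>A. \<exists>B\<in>b. x \<in> B" using b by (auto simp: partition_on_def)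
  then obtain c where c: "\<And>x. x \<in> A \<Longrightarrow> c x \<in> b" "\<And>x. x \<in> A \<Longrightarrow> x \<in> c x" by metis
  have c_eq: "c x = B" if "B \<in> b" "x \<in> B" for x B
    using partition_on_same_block[OF b c(1) that(1) c(2) that(2)] BA that by blast
  have "\<forall>C\<in>F1 \<union> F2. \<exists>B\<in>b. C \<subseteq> B" using F1(2) F2(2) by (auto simp: inside_def)
  then obtain cb where cb: "\<And>C. C \<in> F1 \<union> F2 \<Longrightarrow> cb C \<in> b" "\<And>C. C \<in> F1 \<union> F2 \<Longrightarrow> C \<subseteq> cb C" by metis
  have ne: "C \<noteq> {}" if "C \<in> F1 \<union> F2" for C
    using block_family_nonempty[OF F1(1) k] block_family_nonempty[OF F2(1) k] that by blast
  have cb_eq: "C \<subseteq> B \<longleftrightarrow> cb C = B" if "C \<in> F1 \<union> F2" "B \<in> b" for C B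
    using inside_block_unique[OF b cb(1)[OF that(1)] that(2) cb(2)[OF that(1)] _ ne[OF that(1)]] cb(2)[OF that(1)] by blast
  have dis: "C = D" if "C \<in> F1 \<and> D \<in> F1 \<or> C \<in> F2 \<and> D \<in> F2" "x \<in> C" "x \<in> D" for C D x
    using that block_family_disjoint[OF F1(1)] block_family_disjoint[OF F2(1)] by blast
  \<comment> \<open>A member of \<open>F\<close> is its own label, which forces the matching to fix
    it; any other member is labelled by its block of \<open>b\<close>.\<close>
  define f where "f C = (if C \<in> F then Inl C else Inr (cb C))" for C
  have "\<exists>\<beta>. bij_betw \<beta> F1 F2 \<and> (\<forall>x\<in>F1. f (\<beta> x) = f x)"
  proof (rule fibrewise_bij_betw[OF fin])
    fix y
    show "card {C \<in> F1. f C = y} = card {C \<in> F2. f C = y}"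
    proof (cases y)
      case (Inl D)
      then have "{C \<in> F1. f C = y} = {C \<in> F2. f C = y}" using F by (auto simp: f_def split: if_splits)
      then show ?thesis by simp
    next
      case (Inr B)
      show ?thesis
      proof (cases "B \<in> b")
        case True
        have "{C \<in> F1. f C = y} = {C \<in> F1. C \<subseteq> B} - {C \<in> F. C \<subseteq> B}"
          using Inr True cb_eq by (auto simp: f_def split: if_splits)
        moreover have "{C \<in> F2. f C = y} = {C \<in> F2. C \<subseteq> B} - {C \<in> F. C \<subseteq> B}"
          using Inr True cb_eq by (auto simp: f_def split: if_splits)
        moreover have "finite F" using F fin finite_subset by blast
        moreover have "{C \<in> F. C \<subseteq> B} \<subseteq> {C \<in> F1. C \<subseteq> B}" "{C \<in> F. C \<subseteq> B} \<subseteq> {C \<in> F2. C \<subseteq> B}"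
          using F by auto
        ultimately show ?thesis using eq[OF True] by (simp add: card_Diff_subset)
      next
        case False
        then have "{C \<in> F1. f C = y} = {}" "{C \<in> F2. f C = y} = {}"
          using cb(1) Inr by (auto simp: f_def split: if_splits)
        then show ?thesis by (simp only:)
      qed
    qed
  qed
  then obtain \<beta> where \<beta>: "bij_betw \<beta> F1 F2" and f\<beta>: "\<And>C. C \<in> F1 \<Longrightarrow> f (\<beta> C) = f C" by blast
  have \<beta>F2: "\<beta> C \<in> F2" if "C \<in> F1" for C using bij_betw_apply[OF \<beta> that] .
  have \<beta>F: "\<beta> C = C" if "C \<in> F" for C
    using f\<beta>[of C] that F by (auto simp: f_def split: if_splits)
  have cb\<beta>: "cb (\<beta> C) = cb C" if "C \<in> F1" for C
    using f\<beta>[OF that] \<beta>F by (auto simp: f_def split: if_splits)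
  have "\<forall>x\<in>\<Union>F1. \<exists>C\<in>F1. x \<in> C" "\<forall>x\<in>\<Union>F2. \<exists>C\<in>F2. x \<in> C" by auto
  then obtain bl1 bl2 where bl: "\<And>x. x \<in> \<Union>F1 \<Longrightarrow> bl1 x \<in> F1 \<and> x \<in> bl1 x"
    "\<And>x. x \<in> \<Union>F2 \<Longrightarrow> bl2 x \<in> F2 \<and> x \<in> bl2 x" by metis
  have bl1: "bl1 x = C" if "C \<in> F1" "x \<in> C" for x C using dis bl(1)[of x] that by blast
  have bl2: "bl2 x = C" if "C \<in> F2" "x \<in> C" for x C using dis bl(2)[of x] that by blast
  \<comment> \<open>A point covered by \<open>F1\<close> is labelled by the partner of its member,
    one covered by \<open>F2\<close> by the member itself. Preserving labels then means carrying
    each \<open>C\<close> to \<open>\<beta> C\<close>.\<close>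
  define d1 where "d1 x = (if x \<in> \<Union>F1 then Inl (\<beta> (bl1 x)) else Inr (c x))" for x
  define d2 where "d2 x = (if x \<in> \<Union>F2 then Inl (bl2 x) else Inr (c x))" for x
  have FA: "C \<subseteq> A" "card C = k" if "C \<in> F1 \<union> F2" for C
    using that F1(1) F2(1) by (auto simp: block_family_def)
  \<comment> \<open>A point of \<open>B\<close> only has to avoid the members inside
    \<open>B\<close>, as all others lie in different blocks of \<open>b\<close>.\<close>
  have rest: "{x \<in> A. x \<notin> \<Union>H \<and> c x = B} = B - \<Union>{C \<in> H. C \<subseteq> B}" if "B \<in> b" "H \<subseteq> F1 \<union> F2" for B H
  proof (intro Set.set_eqI iffI)
    fix x assume x: "x \<in> B - \<Union>{C \<in> H. C \<subseteq> B}"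
    then have "x \<in> A" "c x = B" using BA c_eq that by auto
    moreover have "x \<notin> C" if "C \<in> H" for C
    proof
      assume "x \<in> C"
      have C: "C \<in> F1 \<union> F2" using that \<open>H \<subseteq> F1 \<union> F2\<close> by blast
      have "cb C = B"
        using partition_on_same_block[OF b cb(1)[OF C] \<open>B \<in> b\<close>, of x] cb(2)[OF C] \<open>x \<in> C\<close> x by blast
      then show False using cb(2)[OF C] x that \<open>x \<in> C\<close> by blast
    qed
    ultimately show "x \<in> {x \<in> A. x \<notin> \<Union>H \<and> c x = B}" by blast
  qed (use c(2) in auto)
  have "\<exists>g. bij_betw g A A \<and> (\<forall>x\<in>A. d2 (g x) = d1 x)"
  proof (rule fibrewise_bij_betw[OF A A])
    fix y
    show "card {x \<in> A. d1 x = y} = card {x \<in> A. d2 x = y}"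
    proof (cases y)
      case (Inl D)
      show ?thesis
      proof (cases "D \<in> F2")
        case True
        then obtain C where C: "C \<in> F1" "\<beta> C = D" using \<beta> by (auto simp: bij_betw_def)
        have uniq: "C' = C" if "C' \<in> F1" "\<beta> C' = D" for C'
          using C that \<beta> by (auto simp: bij_betw_def inj_on_def)
        have "{x \<in> A. d1 x = y} = C"
        proof (intro Set.set_eqI iffI)
          fix x assume "x \<in> {x \<in> A. d1 x = y}"
          then have "x \<in> \<Union>F1" "\<beta> (bl1 x) = D" using Inl by (auto simp: d1_def split: if_splits)
          then show "x \<in> C" using uniq bl(1) by blast
        next
          fix x assume x: "x \<in> C"
          then have "x \<in> A" "x \<in> \<Union>F1" "bl1 x = C" using C FA(1) bl1 by auto
          then show "x \<in> {x \<in> A. d1 x = y}" using Inl C(2) by (simp add: d1_def)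
        qed
        moreover have "{x \<in> A. d2 x = y} = D"
        proof (intro Set.set_eqI iffI)
          fix x assume "x \<in> {x \<in> A. d2 x = y}"
          then have "x \<in> \<Union>F2" "bl2 x = D" using Inl by (auto simp: d2_def split: if_splits)
          then show "x \<in> D" using bl(2) by blast
        next
          fix x assume x: "x \<in> D"
          then have "x \<in> A" "x \<in> \<Union>F2" "bl2 x = D" using True FA(1) bl2 by auto
          then show "x \<in> {x \<in> A. d2 x = y}" using Inl by (simp add: d2_def)
        qed
        ultimately show ?thesis using FA(2) C(1) True by simp
      next
        case False
        have "{x \<in> A. d1 x = y} = {}" "{x \<in> A. d2 x = y} = {}"
          using Inl False bl \<beta>F2 by (auto simp: d1_def d2_def split: if_splits)
        then show ?thesis by (simp only:)
      qed
    next
      case (Inr B)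
      show ?thesis
      proof (cases "B \<in> b")
        case True
        have "{x \<in> A. d1 x = y} = {x \<in> A. x \<notin> \<Union>F1 \<and> c x = B}"
          "{x \<in> A. d2 x = y} = {x \<in> A. x \<notin> \<Union>F2 \<and> c x = B}"
          using Inr by (auto simp: d1_def d2_def split: if_splits)
        then show ?thesis
          using rest[OF True, of F1] rest[OF True, of F2] eq[OF True]
            card_Diff_Union_family[OF A b F1(1) True] card_Diff_Union_family[OF A b F2(1) True] by simp
      next
        case False
        have "{x \<in> A. d1 x = y} = {}" "{x \<in> A. d2 x = y} = {}"
          using Inr False c(1) by (auto simp: d1_def d2_def split: if_splits)
        then show ?thesis by (simp only:)
      qed
    qed
  qed
  then obtain g0 where g0: "bij_betw g0 A A" "\<And>x. x \<in> A \<Longrightarrow> d2 (g0 x) = d1 x" by blast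
  define g where "g x = (if x \<in> A then g0 x else x)" for x
  have g: "g permutes A"
  proof (rule bij_imp_permutes)
    show "bij_betw g A A" using g0(1) by (rule bij_betw_cong[THEN iffD1, rotated]) (simp add: g_def)
  qed (simp add: g_def)
  have dg: "d2 (g x) = d1 x" if "x \<in> A" for x using g0(2) that by (simp add: g_def)
  have inj: "inj_on g S" for S using permutes_inj[OF g] inj_on_subset by blast
  \<comment> \<open>From here on inclusions suffice, because finite sets of equal size are
    compared.\<close>
  have eqI: "g ` S = S'" if "g ` S \<subseteq> S'" "finite S'" "card S' = card S" for S S'
    using that card_image[OF inj, of S] by (intro card_subset_eq) auto
  have g\<beta>: "g x \<in> \<beta> C" if "C \<in> F1" "x \<in> C" for C x
  proof -
    have "x \<in> A" using FA(1) that by blast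
    moreover have "d1 x = Inl (\<beta> C)" using that bl1[OF that] by (auto simp: d1_def)
    ultimately have "d2 (g x) = Inl (\<beta> C)" using dg by simp
    then have "g x \<in> \<Union>F2" "bl2 (g x) = \<beta> C" by (auto simp: d2_def split: if_splits)
    then show ?thesis using bl(2) by blast
  qed
  have gC: "g ` C = \<beta> C" if "C \<in> F1" for C
  proof (rule eqI)
    show "g ` C \<subseteq> \<beta> C" using g\<beta>[OF that] by blast
    show "finite (\<beta> C)" using FA(1)[of "\<beta> C"] \<beta>F2[OF that] finite_subset[OF _ A] by blast
    show "card (\<beta> C) = card C" using FA(2) \<beta>F2[OF that] that by simp
  qed
  have gB: "g ` B = B" if B: "B \<in> b" for B
  proof (rule eqI)
    show "g ` B \<subseteq> B"
    proof
      fix y assume "y \<in> g ` B"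
      then obtain x where x: "x \<in> B" "y = g x" by blast
      then have xA: "x \<in> A" using BA B by blast
      then have yA: "y \<in> A" using x permutes_in_image[OF g] by simp
      show "y \<in> B"
      proof (cases "x \<in> \<Union>F1")
        case True
        then obtain C where C: "C \<in> F1" "x \<in> C" by blast
        then have "cb C = B" using partition_on_same_block[OF b cb(1) B, of C x] cb(2)[of C] x by blast
        then have "cb (\<beta> C) = B" using cb\<beta> C by simp
        moreover have "\<beta> C \<subseteq> cb (\<beta> C)" using cb(2) \<beta>F2 C by blast
        ultimately show ?thesis using g\<beta>[OF C] x by blast
      next
        case False
        then have "d2 y = Inr B" using dg[OF xA] x c_eq[OF B] by (simp add: d1_def)
        then have "c y = B" by (auto simp: d2_def split: if_splits)
        then show ?thesis using c(2)[OF yA] by simp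
      qed
    qed
  qed (use finB[OF B] in auto)
  have "(`) g ` F1 = \<beta> ` F1" using gC by (intro image_cong) auto
  then have "(`) g ` F1 = F2" using \<beta> by (simp add: bij_betw_def)
  moreover have "g ` C = C" if "C \<in> F" for C using gC \<beta>F that F by blast
  ultimately show ?thesis using g gB by blast
qed

section \<open>Partitions into blocks of sizes 1 and k\<close>

lemma permute_partition_comp:
  "permute_partition (g \<circ> h) p = permute_partition g (permute_partition h p)"
  by (simp add: permute_partition_def image_image image_comp comp_def)

lemma permute_partition_id: "permute_partition id p = p"
  by (simp add: permute_partition_def)

lemma partition_on_permute_partition:
  assumes "g permutes A" "partition_on A p"
  shows "partition_on A (permute_partition g p)"
proof (rule partition_onI)
  show "\<Union>(permute_partition g p) = A"
    using permutes_image[OF assms(1)] assms(2)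
    by (simp add: permute_partition_def partition_on_def flip: image_Union)
  show "{} \<notin> permute_partition g p"
    using assms(2) by (auto simp: permute_partition_def partition_on_def)
  fix B C assume "B \<in> permute_partition g p" "C \<in> permute_partition g p" "B \<noteq> C"
  then obtain B' C' where "B' \<in> p" "C' \<in> p" "B = g ` B'" "C = g ` C'" "B' \<noteq> C'"
    by (auto simp: permute_partition_def)
  then show "disjnt B C"
    using assms(2) permutes_inj[OF assms(1)]
    by (auto simp: disjnt_def partition_on_def disjoint_def simp flip: image_Int)
qed

lemma refines_permute_partition:
  assumes "g permutes A" "refines A p q"
  shows "refines A (permute_partition g p) (permute_partition g q)"
proof -
  have "\<exists>Y\<in>permute_partition g q. W \<subseteq> Y" if W: "W \<in> permute_partition g p" for W
  proof -
    obtain U where U: "U \<in> p" "W = g ` U" using W by (auto simp: permute_partition_def)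
    then obtain Y where "Y \<in> q" "U \<subseteq> Y" using assms(2) unfolding refines_def by blast
    then show ?thesis using U(2) unfolding permute_partition_def by (meson image_eqI image_mono)
  qed
  then show ?thesis
    using assms(2) partition_on_permute_partition[OF assms(1)] unfolding refines_def by blast
qed

lemma permute_partition_inv:
  assumes "g permutes A"
  shows "permute_partition (inv' g) (permute_partition g p) = p"
    and "permute_partition g (permute_partition (inv' g) p) = p"
  using permutes_inv_o[OF assms]
  by (simp_all add: permute_partition_id flip: permute_partition_comp)

lemma partition_type_permute_partition:
  assumes "g permutes A"
  shows "partition_type (permute_partition g p) = partition_type p"
proof -
  have inj: "inj g" by (rule permutes_inj[OF assms])
  then have "inj_on ((`) g) p" by (simp add: inj_on_def inj_image_eq_iff)
  then have "partition_type (permute_partition g p) = image_mset (\<lambda>B. card (g ` B)) (mset_set p)"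
    by (simp add: partition_type_def permute_partition_def image_mset.compositionality comp_def
      flip: image_mset_mset_set)
  also have "\<dots> = partition_type p"
    using inj by (simp add: partition_type_def card_image inj_on_subset)
  finally show ?thesis .
qed

lemma sum_partition_type:
  "(\<Sum>x\<in>#partition_type p. f x) = (\<Sum>B\<in>p. f (card B))"
  by (simp add: partition_type_def image_mset.compositionality comp_def sum_unfold_sum_mset)

lemma partition_on_mem: "partition_on A p \<Longrightarrow> x \<in> A \<Longrightarrow> \<exists>B\<in>p. x \<in> B"
  by (auto simp: partition_on_def)

locale closed_partition_types =
  fixes n k :: nat and \<Lambda> :: "nat multiset set"
  assumes k2: "2 \<le> k" and kn: "k < n"
    and \<Lambda>_partitions: "\<Lambda> \<subseteq> number_partitions n"
    and \<Lambda>_nonempty: "\<Lambda> \<noteq> {}"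
    and \<Lambda>_closed: "\<mu> \<in> \<Lambda> \<Longrightarrow>
       replicate_mset (\<Sum>x\<in>#\<mu>. x div k) k + replicate_mset (\<Sum>x\<in>#\<mu>. x mod k) 1 \<in> \<Lambda>"
begin

abbreviation "A \<equiv> {1..n}"
abbreviation "P \<equiv> Pi_poset n \<Lambda>"
abbreviation "leq \<equiv> refines {1..n}"
abbreviation "fam \<equiv> block_family {1..n} k"

text \<open>Together with \<open>kblocks\<close> this translates between \<open>K\<close> and
  families of disjoint k-sets; k being at least 2 keeps the added singletons apart from the
  family.\<close>

definition from_blocks :: "nat set set \<Rightarrow> nat set set" where
  "from_blocks F = F \<union> (\<lambda>x. {x}) ` (A - \<Union>F)"

definition kblocks :: "nat set set \<Rightarrow> nat set set" where
  "kblocks p = {C \<in> p. card C = k}"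

definition K :: "nat set set set" where
  "K = {p \<in> P. \<forall>C\<in>p. card C = k \<or> card C = 1}"

lemma k0: "0 < k" using k2 by simp

lemma P_partition: "p \<in> P \<Longrightarrow> partition_on A p"
  by (simp add: Pi_poset_def)

lemma K_P: "K \<subseteq> P" by (auto simp: K_def)

lemma fam_finite: "fam F \<Longrightarrow> finite F"
  by (rule finite_block_family[OF finite_atLeastAtMost])

lemma partition_from_blocks:
  assumes "fam F"
  shows "partition_on A (from_blocks F)"
proof (rule partition_onI)
  show "\<Union>(from_blocks F) = A" using assms by (auto simp: from_blocks_def block_family_def)
  show "{} \<notin> from_blocks F" using block_family_nonempty[OF assms k0] by (auto simp: from_blocks_def)
  show "disjnt B C" if "B \<in> from_blocks F" "C \<in> from_blocks F" "B \<noteq> C" for B C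
    using that block_family_disjoint[OF assms] unfolding from_blocks_def disjnt_def by auto
qed

lemma kblocks_from_blocks:
  assumes "fam F"
  shows "kblocks (from_blocks F) = F"
  using assms k2 by (auto simp: kblocks_def from_blocks_def block_family_def)

lemma fam_kblocks:
  assumes "partition_on A p"
  shows "fam (kblocks p)"
  using assms by (auto simp: kblocks_def block_family_def partition_on_def intro: pairwise_subset)

lemma from_blocks_kblocks:
  assumes p: "partition_on A p" "\<forall>C\<in>p. card C = k \<or> card C = 1"
  shows "from_blocks (kblocks p) = p"
proof (intro Set.set_eqI iffI)
  fix C assume "C \<in> from_blocks (kblocks p)"
  then consider "C \<in> kblocks p" | x where "C = {x}" "x \<in> A" "x \<notin> \<Union>(kblocks p)"
    by (auto simp: from_blocks_def)
  then show "C \<in> p"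
  proof cases
    case 2
    then obtain D where "D \<in> p" "x \<in> D" using partition_on_mem[OF p(1) 2(2)] by blast
    then have "card D = 1" using 2(3) p(2) by (auto simp: kblocks_def)
    then have "D = {x}" using \<open>x \<in> D\<close> by (auto simp: card_1_singleton_iff)
    then show ?thesis using 2 \<open>D \<in> p\<close> by simp
  qed (simp add: kblocks_def)
next
  fix C assume C: "C \<in> p"
  show "C \<in> from_blocks (kblocks p)"
  proof (cases "card C = k")
    case False
    then obtain x where x: "C = {x}" using p(2) C by (auto simp: card_1_singleton_iff)
    then have "x \<in> A" using C p(1) by (auto simp: partition_on_def)
    moreover have "x \<notin> D" if "D \<in> kblocks p" for D
      using partition_on_same_block[OF p(1) C, of D x] that x False by (auto simp: kblocks_def)
    ultimately show ?thesis using x by (auto simp: from_blocks_def)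
  qed (use C in \<open>simp add: from_blocks_def kblocks_def\<close>)
qed

lemma K_eq: "p \<in> K \<Longrightarrow> from_blocks (kblocks p) = p"
  by (rule from_blocks_kblocks) (auto simp: K_def Pi_poset_def)

lemma K_fam: "p \<in> K \<Longrightarrow> fam (kblocks p)"
  by (rule fam_kblocks) (auto simp: K_def Pi_poset_def)

lemma from_blocks_K:
  assumes "fam F" "from_blocks F \<in> P"
  shows "from_blocks F \<in> K"
  using assms by (auto simp: K_def from_blocks_def block_family_def)

lemma card_fam_le: "fam F \<Longrightarrow> k * card F \<le> n"
  using card_Union_block_family[of A k F] card_mono[of A "\<Union>F"] by (auto simp: block_family_def)

lemma partition_type_from_blocks:
  assumes F: "fam F"
  shows "partition_type (from_blocks F) = replicate_mset (card F) k + replicate_mset (n - k * card F) 1"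
proof -
  let ?S = "(\<lambda>x. {x}) ` (A - \<Union>F)"
  have disj: "F \<inter> ?S = {}" using F k2 by (auto simp: block_family_def)
  have cS: "card ?S = n - k * card F"
  proof -
    have "\<Union>F \<subseteq> A" using F by (auto simp: block_family_def)
    then show ?thesis
      using card_Union_block_family[OF _ F] finite_subset[of "\<Union>F" A]
      by (simp add: card_image card_Diff_subset)
  qed
  have "partition_type (from_blocks F) = image_mset card (mset_set F) + image_mset card (mset_set ?S)"
    using disj fam_finite[OF F] by (simp add: partition_type_def from_blocks_def mset_set_Union)
  also have "image_mset card (mset_set F) = image_mset (\<lambda>_. k) (mset_set F)"
    using F fam_finite[OF F] by (intro image_mset_cong) (auto simp: block_family_def)
  also have "image_mset card (mset_set ?S) = image_mset (\<lambda>_. 1) (mset_set ?S)"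
    by (intro image_mset_cong) auto
  finally show ?thesis by (simp add: image_mset_const_eq cS del: One_nat_def)
qed

lemma from_blocks_P:
  assumes "fam F" "replicate_mset (card F) k + replicate_mset (n - k * card F) 1 \<in> \<Lambda>"
  shows "from_blocks F \<in> P"
  using assms partition_from_blocks partition_type_from_blocks by (simp add: Pi_poset_def)

text \<open>The parts of \<open>\<mu>\<close> sum to \<open>n\<close>, so the number of ones is
  \<open>n - k * a\<close>. In this form the type depends on the number of k-blocks alone, matching
  \<open>partition_type_from_blocks\<close>.\<close>

lemma \<Lambda>_closed':
  assumes "\<mu> \<in> \<Lambda>" "a = (\<Sum>x\<in>#\<mu>. x div k)"
  shows "replicate_mset a k + replicate_mset (n - k * a) 1 \<in> \<Lambda>" "k * a \<le> n"
proof -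
  have "n = (\<Sum>x\<in>#\<mu>. x)" using \<Lambda>_partitions assms(1) by (auto simp: number_partitions_def)
  also have "\<dots> = (\<Sum>x\<in>#\<mu>. k * (x div k) + x mod k)" by simp
  also have "\<dots> = k * a + (\<Sum>x\<in>#\<mu>. x mod k)"
    unfolding sum_mset.distrib assms(2) by (simp add: sum_mset_distrib_left)
  finally have eq: "n = k * a + (\<Sum>x\<in>#\<mu>. x mod k)" .
  then show "k * a \<le> n" by linarith
  have "n - k * a = (\<Sum>x\<in>#\<mu>. x mod k)" using eq by linarith
  then show "replicate_mset a k + replicate_mset (n - k * a) 1 \<in> \<Lambda>"
    using \<Lambda>_closed[OF assms(1)] assms(2) by simp
qed

text \<open>Provides the candidates for a chain contained in \<open>K\<close>, where no least
  element of \<open>\<sigma> - K\<close> is available.\<close>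

lemma K_nonempty: "K \<noteq> {}"
proof -
  obtain \<mu> where \<mu>: "\<mu> \<in> \<Lambda>" using \<Lambda>_nonempty by blast
  define a where "a = (\<Sum>x\<in>#\<mu>. x div k)"
  obtain F where F: "fam F" "card F = a"
    using block_family_exists[of A k a] \<Lambda>_closed'(2)[OF \<mu> a_def] k0 by auto
  then have "from_blocks F \<in> P" using \<Lambda>_closed'(1)[OF \<mu> a_def] by (intro from_blocks_P) simp_all
  then show ?thesis using from_blocks_K[OF F(1)] by blast
qed

lemma from_blocks_refines_iff:
  assumes F: "fam F" and b: "partition_on A b"
  shows "leq (from_blocks F) b \<longleftrightarrow> inside F b"
proof
  assume "inside F b"
  moreover have "\<exists>Y\<in>b. {x} \<subseteq> Y" if "x \<in> A" for x
    using partition_on_mem[OF b that] by blast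
  ultimately show "leq (from_blocks F) b"
    using partition_from_blocks[OF F] b by (simp add: refines_def from_blocks_def inside_def ball_Un)
qed (auto simp: refines_def inside_def from_blocks_def)

lemma K_refines_iff:
  assumes "q \<in> K" "partition_on A b"
  shows "leq q b \<longleftrightarrow> inside (kblocks q) b"
  using from_blocks_refines_iff[OF K_fam[OF assms(1)] assms(2)] K_eq[OF assms(1)] by simp

text \<open>A k-block inside a block of size 1 or k fills it, so refinement within \<open>K\<close>
  is inclusion of families.\<close>

lemma K_leq_iff:
  assumes "p \<in> K" "q \<in> K"
  shows "leq p q \<longleftrightarrow> kblocks p \<subseteq> kblocks q"
proof -
  have q: "partition_on A q" using assms(2) K_P P_partition by blast
  have "inside (kblocks p) q \<longleftrightarrow> kblocks p \<subseteq> kblocks q"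
  proof
    assume ins: "inside (kblocks p) q"
    show "kblocks p \<subseteq> kblocks q"
    proof
      fix C assume C: "C \<in> kblocks p"
      then obtain D where D: "D \<in> q" "C \<subseteq> D" using ins by (auto simp: inside_def)
      have "finite D" using D(1) q finite_subset[of D A] by (auto simp: partition_on_def)
      moreover have "card C = k" using C by (simp add: kblocks_def)
      moreover have "card C \<le> card D" using \<open>finite D\<close> D(2) by (rule card_mono)
      moreover have "card D = k \<or> card D = 1" using D(1) assms(2) by (simp add: K_def)
      ultimately have "card D = card C" using k2 by linarith
      then have "C = D" using card_subset_eq[OF \<open>finite D\<close> D(2)] by simp
      then show "C \<in> kblocks q" using D \<open>card C = k\<close> by (simp add: kblocks_def)
    qed
  qed (auto simp: inside_def kblocks_def)
  then show ?thesis using K_refines_iff[OF assms(1) q] by simp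
qed

section \<open>Candidates for the cone over a chain of partitions\<close>

text \<open>Defining the candidates by maximality avoids naming the least element of
  \<open>\<rho>\<close>; it covers the empty set and uses only notions that permutations
  respect.\<close>

definition T :: "nat set set set \<Rightarrow> nat set set set" where
  "T \<rho> = {q \<in> K. (\<forall>x\<in>\<rho>. leq q x) \<and>
     (\<forall>r\<in>K. (\<forall>x\<in>\<rho>. leq r x) \<longrightarrow> card (kblocks r) \<le> card (kblocks q))}"

sublocale finite_order P leq
proof
  show "finite P"
    by (rule finite_subset[OF _ finitely_many_partition_on[OF finite_atLeastAtMost]])
      (auto simp: Pi_poset_def)
  show "leq x x" if "x \<in> P" for x by (rule refines_refl[OF P_partition[OF that]])
qed (rule refines_asym)

lemma chain_min:
  assumes "\<sigma> \<in> OC" "S \<subseteq> \<sigma>" "S \<noteq> {}"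
  shows "\<exists>b\<in>S. \<forall>x\<in>S. leq b x"
  using finite_subset[OF assms(2) OC_finite[OF assms(1)]] assms(3,2)
proof (induction S rule: finite_ne_induct)
  case (singleton x)
  then show ?case using OC_in_P[OF assms(1)] leq_refl by simp
next
  case (insert x S)
  then obtain b where b: "b \<in> S" "\<forall>y\<in>S. leq b y" by auto
  have "leq x x" using insert.prems OC_in_P[OF assms(1)] leq_refl by simp
  moreover have "leq x b \<or> leq b x"
    using assms(1) insert.prems b(1) unfolding order_complex_def by blast
  ultimately show ?case using b refines_trans by blast
qed

lemma chain_max:
  assumes "\<sigma> \<in> OC" "S \<subseteq> \<sigma>" "S \<noteq> {}"
  shows "\<exists>b\<in>S. \<forall>x\<in>S. leq x b"
  using finite_subset[OF assms(2) OC_finite[OF assms(1)]] assms(3,2)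
proof (induction S rule: finite_ne_induct)
  case (singleton x)
  then show ?case using OC_in_P[OF assms(1)] leq_refl by simp
next
  case (insert x S)
  then obtain b where b: "b \<in> S" "\<forall>y\<in>S. leq y b" by auto
  have "leq x x" using insert.prems OC_in_P[OF assms(1)] leq_refl by simp
  moreover have "leq x b \<or> leq b x"
    using assms(1) insert.prems b(1) unfolding order_complex_def by blast
  ultimately show ?case using b refines_trans by blast
qed

text \<open>
  The pair \<open>(b, m)\<close> describes the elements of \<open>T (\<sigma> - K)\<close>: they have exactly \<open>m B\<close> blocks of
  size \<open>k\<close> in every block \<open>B\<close> of \<open>b\<close>. If \<open>\<sigma> - K\<close> is empty, then \<open>b\<close> has a single block.
\<close>

lemma T_bound:
  assumes \<sigma>: "\<sigma> \<in> OC"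
  obtains b m where "partition_on A b" "\<And>B. B \<in> b \<Longrightarrow> k * m B \<le> card B"
    "\<And>q. q \<in> K \<Longrightarrow> (\<forall>x\<in>\<sigma> - K. leq q x) \<longleftrightarrow> leq q b"
    "\<And>q B. q \<in> K \<Longrightarrow> leq q b \<Longrightarrow> B \<in> b \<Longrightarrow> card {C \<in> kblocks q. C \<subseteq> B} \<le> m B"
    "\<And>F. fam F \<Longrightarrow> inside F b \<Longrightarrow> \<forall>B\<in>b. card {C \<in> F. C \<subseteq> B} = m B \<Longrightarrow> from_blocks F \<in> K"
    "\<And>x. x \<in> \<sigma> - K \<Longrightarrow> leq b x" "\<And>x. x \<in> \<sigma> \<inter> K \<Longrightarrow> leq x b \<or> leq b x"
proof (cases "\<sigma> - K = {}")
  case True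
  have finK: "finite K" using K_P finite_P finite_subset by blast
  \<comment> \<open>For a chain inside \<open>K\<close> the bound is the largest number of k-blocks
    attained in \<open>K\<close>. Any family of that size gives an element of \<open>K\<close>,
    because it has the type of an attaining element.\<close>
  define M where "M = Max ((\<lambda>q. card (kblocks q)) ` K)"
  have M: "card (kblocks q) \<le> M" if "q \<in> K" for q
    unfolding M_def using finK that by simp
  have "M \<in> (\<lambda>q. card (kblocks q)) ` K"
    unfolding M_def using finK K_nonempty by (intro Max_in) auto
  then obtain q where q: "q \<in> K" "card (kblocks q) = M" by blast
  have A: "partition_on A {A}" using kn by (intro partition_on_space) auto
  have leqA: "leq p {A}" if "p \<in> P" for p
    using P_partition[OF that] A by (auto simp: refines_def partition_on_def)
  have whole: "{C \<in> F. C \<subseteq> A} = F" if "fam F" for F using that by (auto simp: block_family_def)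
  show thesis
  proof (rule that[of "{A}" "\<lambda>_. M"])
    show "k * M \<le> card B" if "B \<in> {A}" for B
      using card_fam_le[OF K_fam[OF q(1)]] q(2) that by simp
    show "(\<forall>x\<in>\<sigma> - K. leq p x) \<longleftrightarrow> leq p {A}" if "p \<in> K" for p
      using True leqA K_P that by auto
    show "card {C \<in> kblocks p. C \<subseteq> B} \<le> M" if "p \<in> K" "B \<in> {A}" for p B
      using M[OF that(1)] whole[OF K_fam[OF that(1)]] that(2) by simp
    show "from_blocks F \<in> K" if F: "fam F" "\<forall>B\<in>{A}. card {C \<in> F. C \<subseteq> B} = M" for F
    proof -
      have "card F = M" using whole[OF F(1)] F(2) by simp
      moreover have "partition_type (from_blocks (kblocks q)) \<in> \<Lambda>"
        using q(1) K_eq K_P by (auto simp: Pi_poset_def)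
      ultimately show ?thesis
        using partition_type_from_blocks[OF K_fam[OF q(1)]] q(2)
        by (intro from_blocks_K from_blocks_P F(1)) simp
    qed
    show "leq {A} x" if "x \<in> \<sigma> - K" for x using True that by blast
    show "leq x {A} \<or> leq {A} x" if "x \<in> \<sigma> \<inter> K" for x using leqA K_P that by blast
  qed (rule A)
next
  case False
  obtain b where b: "b \<in> \<sigma> - K" "\<And>x. x \<in> \<sigma> - K \<Longrightarrow> leq b x"
    using chain_min[OF \<sigma> _ False] by blast
  have bP: "b \<in> P" using OC_in_P[OF \<sigma>] b(1) by blast
  note pb = P_partition[OF bP]
  show thesis
  \<comment> \<open>\<open>b\<close> is the least element of \<open>\<sigma> - K\<close>, and
    \<open>card B div k\<close> is the number of disjoint k-sets that fit into
    \<open>B\<close>.\<close>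
  proof (rule that[of b "\<lambda>B. card B div k"])
    show "(\<forall>x\<in>\<sigma> - K. leq p x) \<longleftrightarrow> leq p b" for p
      using b refines_trans by blast
    show "card {C \<in> kblocks p. C \<subseteq> B} \<le> card B div k" if "p \<in> K" "B \<in> b" for p B
      using card_inside_le[OF _ pb K_fam[OF that(1)] that(2)] k0
      by (simp add: less_eq_div_iff_mult_less_eq mult.commute)
    show "from_blocks F \<in> K" if F: "fam F" "inside F b" "\<forall>B\<in>b. card {C \<in> F. C \<subseteq> B} = card B div k" for F
    proof -
      have "card F = (\<Sum>B\<in>b. card B div k)"
        using card_inside_eq_sum[OF _ pb F(1,2) k0] F(3) by simp
      then have "card F = (\<Sum>x\<in>#partition_type b. x div k)" by (simp add: sum_partition_type)
      moreover have "partition_type b \<in> \<Lambda>" using bP by (simp add: Pi_poset_def)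
      ultimately show ?thesis
        using \<Lambda>_closed'(1) by (intro from_blocks_K from_blocks_P F(1)) blast
    qed
    show "leq x b \<or> leq b x" if "x \<in> \<sigma> \<inter> K" for x
      using \<sigma> b(1) that unfolding order_complex_def by blast
  qed (use pb b(2) in auto)
qed

text \<open>The elements of \<open>\<sigma>\<close> not above \<open>b\<close> lie in
  \<open>K\<close> below \<open>b\<close>; their families are nested, and \<open>F\<close> can be
  taken as the largest, or empty. Choosing a candidate then means extending \<open>F\<close> to
  prescribed counts in the blocks of \<open>b\<close>, to which the results on block families
  apply.\<close>

lemma cone_structure:
  assumes \<sigma>: "\<sigma> \<in> OC"
  obtains b m F where "partition_on A b" "fam F" "inside F b"
    "\<And>B. B \<in> b \<Longrightarrow> k * m B \<le> card B" "\<And>B. B \<in> b \<Longrightarrow> card {C \<in> F. C \<subseteq> B} \<le> m B"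
    "\<And>q. q \<in> T (\<sigma> - K) \<and> insert q \<sigma> \<in> OC \<longleftrightarrow> (\<exists>H. q = from_blocks H \<and> fam H \<and> inside H b \<and> F \<subseteq> H
        \<and> (\<forall>B\<in>b. card {C \<in> H. C \<subseteq> B} = m B))"
    "\<And>x. x \<in> \<sigma> \<Longrightarrow> leq b x \<or> x \<in> K \<and> kblocks x \<subseteq> F"
proof (rule T_bound[OF \<sigma>])
  fix b m
  assume b: "partition_on A b" and km: "\<And>B. B \<in> b \<Longrightarrow> k * m B \<le> card B"
    and below: "\<And>q. q \<in> K \<Longrightarrow> (\<forall>x\<in>\<sigma> - K. leq q x) \<longleftrightarrow> leq q b"
    and bound: "\<And>q B. q \<in> K \<Longrightarrow> leq q b \<Longrightarrow> B \<in> b \<Longrightarrow> card {C \<in> kblocks q. C \<subseteq> B} \<le> m B"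
    and inK: "\<And>F. fam F \<Longrightarrow> inside F b \<Longrightarrow> \<forall>B\<in>b. card {C \<in> F. C \<subseteq> B} = m B \<Longrightarrow> from_blocks F \<in> K"
    and nonK: "\<And>x. x \<in> \<sigma> - K \<Longrightarrow> leq b x" and comp: "\<And>x. x \<in> \<sigma> \<inter> K \<Longrightarrow> leq x b \<or> leq b x"
  have finb: "finite b" by (rule finite_elements[OF _ b]) simp
  have card_K: "card (kblocks q) = (\<Sum>B\<in>b. card {C \<in> kblocks q. C \<subseteq> B})" if "q \<in> K" "leq q b" for q
    by (rule card_inside_eq_sum[OF _ b K_fam[OF that(1)] _ k0])
      (use K_refines_iff[OF that(1) b] that(2) in simp_all)
  have T_iff: "q \<in> T (\<sigma> - K) \<longleftrightarrow> q \<in> K \<and> leq q b \<and> (\<forall>B\<in>b. card {C \<in> kblocks q. C \<subseteq> B} = m B)" for q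
  proof
    assume q: "q \<in> T (\<sigma> - K)"
    then have qK: "q \<in> K" and qb: "leq q b" using below by (auto simp: T_def)
    \<comment> \<open>A competitor attaining every bound \<open>m B\<close>. A maximal
      \<open>q\<close> has at least as many k-blocks in total, so none of its own bounds can be
      strict.\<close>
    obtain H where H: "fam H" "inside H b" "\<forall>B\<in>b. card {C \<in> H. C \<subseteq> B} = m B"
      using block_family_extend[OF _ b k0, of "{}" m] km by (auto simp: block_family_def inside_def)
    let ?r = "from_blocks H"
    have r: "?r \<in> K" by (rule inK[OF H])
    have rb: "leq ?r b" using from_blocks_refines_iff[OF H(1) b] H(2) by simp
    then have "card (kblocks ?r) \<le> card (kblocks q)"
      using q r below[OF r] by (simp add: T_def)
    then have "(\<Sum>B\<in>b. m B) \<le> (\<Sum>B\<in>b. card {C \<in> kblocks q. C \<subseteq> B})"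
      using card_K[OF r rb] card_K[OF qK qb] H(3) kblocks_from_blocks[OF H(1)] by simp
    moreover have "(\<Sum>B\<in>b. card {C \<in> kblocks q. C \<subseteq> B}) \<le> (\<Sum>B\<in>b. m B)"
      by (rule sum_mono) (rule bound[OF qK qb])
    ultimately have "(\<Sum>B\<in>b. card {C \<in> kblocks q. C \<subseteq> B}) = (\<Sum>B\<in>b. m B)" by simp
    then have "\<forall>B\<in>b. card {C \<in> kblocks q. C \<subseteq> B} = m B"
      using bound[OF qK qb] finb by (intro ballI) (rule sum_mono_inv)
    then show "q \<in> K \<and> leq q b \<and> (\<forall>B\<in>b. card {C \<in> kblocks q. C \<subseteq> B} = m B)"
      using qK qb by simp
  next
    assume q: "q \<in> K \<and> leq q b \<and> (\<forall>B\<in>b. card {C \<in> kblocks q. C \<subseteq> B} = m B)"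
    have "card (kblocks r) \<le> card (kblocks q)" if r: "r \<in> K" "\<forall>x\<in>\<sigma> - K. leq r x" for r
    proof -
      have rb: "leq r b" using below[OF r(1)] r(2) by simp
      then show ?thesis
        using card_K[OF r(1) rb] card_K[of q] q sum_mono[OF bound[OF r(1) rb], of b] by simp
    qed
    then show "q \<in> T (\<sigma> - K)" using q below[of q] by (simp add: T_def)
  qed
  let ?L = "{l \<in> \<sigma> \<inter> K. leq l b}"
  obtain F where F: "fam F" "inside F b" "\<And>B. B \<in> b \<Longrightarrow> card {C \<in> F. C \<subseteq> B} \<le> m B"
    and FL: "\<And>l. l \<in> ?L \<Longrightarrow> kblocks l \<subseteq> F" "F = {} \<or> (\<exists>l\<in>?L. F = kblocks l)"
  proof (cases "?L = {}")
    case True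
    show thesis
      by (rule that[of "{}"]) (use True in \<open>auto simp: block_family_def inside_def\<close>)
  next
    case False
    obtain l where l: "l \<in> ?L" "\<And>x. x \<in> ?L \<Longrightarrow> leq x l"
      using chain_max[OF \<sigma> _ False] by blast
    show thesis
    proof (rule that[of "kblocks l"])
      show "inside (kblocks l) b" using l(1) K_refines_iff[OF _ b] by blast
      show "kblocks x \<subseteq> kblocks l" if "x \<in> ?L" for x
        using l(2)[OF that] K_leq_iff[of x l] that l(1) by simp
    qed (use l(1) K_fam bound in auto)
  qed
  show thesis
  proof (rule that[of b F m])
    fix q
    show "q \<in> T (\<sigma> - K) \<and> insert q \<sigma> \<in> OC \<longleftrightarrow> (\<exists>H. q = from_blocks H \<and> fam H \<and> inside H b \<and> F \<subseteq> H
        \<and> (\<forall>B\<in>b. card {C \<in> H. C \<subseteq> B} = m B))"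
    proof
      assume q: "q \<in> T (\<sigma> - K) \<and> insert q \<sigma> \<in> OC"
      then have q': "q \<in> K" "leq q b" "\<forall>B\<in>b. card {C \<in> kblocks q. C \<subseteq> B} = m B"
        using T_iff by blast+
      have "F \<subseteq> kblocks q"
        using FL(2)
      proof
        assume "\<exists>l\<in>?L. F = kblocks l"
        then obtain l where l: "l \<in> \<sigma>" "l \<in> K" "leq l b" "F = kblocks l" by blast
        have "leq l q \<or> leq q l" using q l(1) unfolding order_complex_def by blast
        then show ?thesis
        proof
          assume "leq l q"
          then show ?thesis using K_leq_iff[OF l(2) q'(1)] l(4) by simp
        next
          \<comment> \<open>Here \<open>l\<close> competes with \<open>q\<close> for maximality, so
            \<open>q\<close> below \<open>l\<close> forces equality.\<close>
          assume "leq q l"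
          then have "kblocks q \<subseteq> kblocks l" using K_leq_iff[OF q'(1) l(2)] by simp
          moreover have "card (kblocks l) \<le> card (kblocks q)"
            using q l(2) below[OF l(2)] l(3) by (simp add: T_def)
          ultimately have "kblocks q = kblocks l"
            using fam_finite[OF K_fam[OF l(2)]] by (intro card_seteq)
          then show ?thesis using l(4) by simp
        qed
      qed simp
      then show "\<exists>H. q = from_blocks H \<and> fam H \<and> inside H b \<and> F \<subseteq> H
        \<and> (\<forall>B\<in>b. card {C \<in> H. C \<subseteq> B} = m B)"
        using q' K_eq[OF q'(1)] K_fam[OF q'(1)] K_refines_iff[OF q'(1) b]
        by (intro exI[of _ "kblocks q"]) simp
    next
      assume "\<exists>H. q = from_blocks H \<and> fam H \<and> inside H b \<and> F \<subseteq> H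
        \<and> (\<forall>B\<in>b. card {C \<in> H. C \<subseteq> B} = m B)"
      then obtain H where H: "q = from_blocks H" "fam H" "inside H b" "F \<subseteq> H"
        "\<forall>B\<in>b. card {C \<in> H. C \<subseteq> B} = m B" by blast
      have qK: "q \<in> K" unfolding H(1) by (rule inK[OF H(2,3,5)])
      have kq: "kblocks q = H" using kblocks_from_blocks[OF H(2)] H(1) by simp
      have qb: "leq q b" using from_blocks_refines_iff[OF H(2) b] H(1,3) by simp
      have "q \<in> T (\<sigma> - K)" using T_iff qK qb kq H(5) by simp
      moreover have "leq q x \<or> leq x q" if x: "x \<in> \<sigma>" for x
      proof (cases "leq b x")
        case True
        then show ?thesis using refines_trans[OF qb] by blast
      next
        case False
        then have "x \<in> ?L" using x nonK comp by blast
        then have "leq x q" using FL(1)[of x] H(4) kq K_leq_iff[of x q] qK by auto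
        then show ?thesis by simp
      qed
      then have "insert q \<sigma> \<in> OC"
        using \<sigma> qK K_P leq_refl[of q] unfolding order_complex_def by auto
      ultimately show "q \<in> T (\<sigma> - K) \<and> insert q \<sigma> \<in> OC" by simp
    qed
  next
    fix x assume x: "x \<in> \<sigma>"
    show "leq b x \<or> x \<in> K \<and> kblocks x \<subseteq> F"
    proof (cases "leq b x")
      case False
      then have "x \<in> ?L" using x nonK comp by blast
      then show ?thesis using FL(1) by blast
    qed simp
  qed (use b F km in auto)
qed

section \<open>The action of the symmetric group on the poset\<close>

sublocale finite_order_action P leq "sym_group n" permute_partition
proof (intro finite_order_action.intro finite_order_action_axioms.intro sym_group_is_group
    finite_order_axioms)
  show "finite (carrier (sym_group n))" by (simp add: sym_group_def finite_permutations)
  show "permute_partition (g \<otimes>\<^bsub>sym_group n\<^esub> h) x = permute_partition g (permute_partition h x)" for g h x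
    by (simp add: sym_group_mult permute_partition_comp)
  show "permute_partition \<one>\<^bsub>sym_group n\<^esub> x = x" for x
    by (simp add: sym_group_one permute_partition_id)
next
  fix g x assume "g \<in> carrier (sym_group n)" "x \<in> P"
  then show "permute_partition g x \<in> P"
    by (auto simp: sym_group_carrier Pi_poset_def partition_on_permute_partition partition_type_permute_partition)
next
  fix g x y assume "g \<in> carrier (sym_group n)" "x \<in> P" "y \<in> P"
  then show "leq (permute_partition g x) (permute_partition g y) \<longleftrightarrow> leq x y"
    using refines_permute_partition[of g A x y] permutes_inv[of g A]
      refines_permute_partition[of "inv' g" A "permute_partition g x" "permute_partition g y"]
    by (auto simp: sym_group_carrier permute_partition_inv(1)[of g A])
qed

lemma kblocks_permute_partition:
  assumes "g permutes A"
  shows "kblocks (permute_partition g p) = (`) g ` kblocks p"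
proof -
  have "card (g ` C) = card C" for C
    by (rule card_image[OF inj_on_subset[OF permutes_inj[OF assms] subset_UNIV]])
  then show ?thesis by (auto simp: kblocks_def permute_partition_def)
qed

lemma card_kblocks_permute_partition:
  assumes "g permutes A"
  shows "card (kblocks (permute_partition g p)) = card (kblocks p)"
  unfolding kblocks_permute_partition[OF assms]
  using permutes_inj[OF assms] by (intro card_image) (auto simp: inj_on_def inj_image_eq_iff)

lemma permute_partition_from_blocks:
  assumes "g permutes A"
  shows "permute_partition g (from_blocks F) = from_blocks ((`) g ` F)"
proof -
  have "g ` (A - \<Union>F) = A - \<Union>((`) g ` F)"
    using permutes_image[OF assms] permutes_inj[OF assms] by (simp add: image_set_diff flip: image_Union)
  moreover have "(`) g ` (\<lambda>x. {x}) ` S = (\<lambda>x. {x}) ` g ` S" for S by auto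
  ultimately show ?thesis
    by (simp only: permute_partition_def from_blocks_def image_Un)
qed

text \<open>Every block of \<open>x\<close> is a union of blocks of \<open>b\<close>, hence is
  mapped into itself.\<close>

lemma permute_partition_coarser:
  assumes g: "g permutes A" and gb: "\<And>B. B \<in> b \<Longrightarrow> g ` B = B" and bx: "leq b x"
  shows "permute_partition g x = x"
proof -
  have x: "partition_on A x" and b: "partition_on A b" using bx by (auto simp: refines_def)
  have "g ` C = C" if C: "C \<in> x" for C
  proof (rule card_subset_eq)
    have CA: "C \<subseteq> A" using C x unfolding partition_on_def by blast
    then show "finite C" using finite_subset by blast
    show "card (g ` C) = card C"
      by (rule card_image[OF inj_on_subset[OF permutes_inj[OF g] subset_UNIV]])
    show "g ` C \<subseteq> C"
    proof
      fix y assume "y \<in> g ` C"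
      then obtain t where t: "t \<in> C" "y = g t" by blast
      then obtain B where B: "B \<in> b" "t \<in> B" using partition_on_mem[OF b, of t] CA by blast
      then obtain D where D: "D \<in> x" "B \<subseteq> D" using bx unfolding refines_def by blast
      then have "D = C" using partition_on_same_block[OF x D(1) C, of t] B t by blast
      moreover have "y \<in> B" using gb[OF B(1)] B(2) t(2) by blast
      ultimately show "y \<in> C" using D(2) by blast
    qed
  qed
  then show ?thesis by (simp add: permute_partition_def)
qed

text \<open>Maximality is transported by moving each competitor back with the inverse permutation.
  The opposite inclusion comes from applying this one to that inverse.\<close>

lemma T_permute_subset:
  assumes g: "g permutes A" and \<rho>: "\<rho> \<subseteq> P" and K: "\<And>g p. g permutes A \<Longrightarrow> p \<in> K \<Longrightarrow> permute_partition g p \<in> K"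
  shows "permute_partition g ` T \<rho> \<subseteq> T (permute_partition g ` \<rho>)"
proof
  fix y assume "y \<in> permute_partition g ` T \<rho>"
  then obtain q where q: "q \<in> T \<rho>" "y = permute_partition g q" by blast
  have max: "card (kblocks r) \<le> card (kblocks q)"
    if r: "r \<in> K" "\<forall>x\<in>\<rho>. leq r (permute_partition g x)" for r
  proof -
    have "leq (permute_partition (inv' g) r) x" if "x \<in> \<rho>" for x
      using refines_permute_partition[OF permutes_inv[OF g], of r "permute_partition g x"] r(2) that
      by (simp add: permute_partition_inv(1)[OF g])
    then have "card (kblocks (permute_partition (inv' g) r)) \<le> card (kblocks q)"
      using q(1) K[OF permutes_inv[OF g] r(1)] by (simp add: T_def)
    then show ?thesis by (simp add: card_kblocks_permute_partition[OF permutes_inv[OF g]])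
  qed
  show "y \<in> T (permute_partition g ` \<rho>)"
    using q(1) K[OF g] refines_permute_partition[OF g] max
    by (auto simp: T_def q(2) card_kblocks_permute_partition[OF g])
qed

text \<open>Existence of a candidate is \<open>block_family_extend\<close>. For transitivity, the
  permutation from \<open>block_family_transitive\<close> fixes the blocks of \<open>b\<close> and
  the members of \<open>F\<close>, and therefore every element of \<open>\<sigma>\<close>.\<close>

sublocale transitive_cones P leq "sym_group n" permute_partition K T
proof (intro transitive_cones.intro transitive_cones_axioms.intro finite_order_action_axioms K_P)
  have K_inv: "permute_partition g p \<in> K" if "g permutes A" "p \<in> K" for g p
  proof -
    have "card (g ` C) = card C" for C
      by (rule card_image[OF inj_on_subset[OF permutes_inj[OF that(1)] subset_UNIV]])
    moreover have "permute_partition g p \<in> P"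
      using \<phi>_P[of g p] that K_P by (auto simp: sym_group_carrier)
    ultimately show ?thesis using that(2) by (auto simp: K_def permute_partition_def)
  qed
  show "permute_partition g p \<in> K" if "g \<in> carrier (sym_group n)" "p \<in> K" for g p
    using K_inv that by (simp add: sym_group_carrier)
  show "T \<rho> \<subseteq> K" for \<rho> by (auto simp: T_def)
  show "T (permute_partition g ` \<rho>) = permute_partition g ` T \<rho>"
    if "g \<in> carrier (sym_group n)" "\<rho> \<subseteq> P" for g \<rho>
  proof (rule subset_antisym)
    have g: "g permutes A" using that(1) by (simp add: sym_group_carrier)
    show "permute_partition g ` T \<rho> \<subseteq> T (permute_partition g ` \<rho>)"
      by (rule T_permute_subset[OF g that(2) K_inv])
    have "permute_partition g ` \<rho> \<subseteq> P" using \<phi>_P that by blast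
    then have "permute_partition (inv' g) ` T (permute_partition g ` \<rho>)
        \<subseteq> T (permute_partition (inv' g) ` permute_partition g ` \<rho>)"
      by (rule T_permute_subset[OF permutes_inv[OF g] _ K_inv])
    also have "\<dots> = T \<rho>" by (simp add: image_image permute_partition_inv(1)[OF g])
    finally have "permute_partition g ` permute_partition (inv' g) ` T (permute_partition g ` \<rho>)
        \<subseteq> permute_partition g ` T \<rho>" by (rule image_mono)
    then show "T (permute_partition g ` \<rho>) \<subseteq> permute_partition g ` T \<rho>"
      by (simp add: image_image permute_partition_inv(2)[OF g])
  qed
next
  fix \<sigma> assume \<sigma>: "\<sigma> \<in> OC"
  show "\<exists>q\<in>T (\<sigma> - K). insert q \<sigma> \<in> OC"
  proof (rule cone_structure[OF \<sigma>])
    fix b m F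
    assume b: "partition_on A b" and F: "fam F" "inside F b"
      and m: "\<And>B. B \<in> b \<Longrightarrow> k * m B \<le> card B" "\<And>B. B \<in> b \<Longrightarrow> card {C \<in> F. C \<subseteq> B} \<le> m B"
      and iff: "\<And>q. q \<in> T (\<sigma> - K) \<and> insert q \<sigma> \<in> OC \<longleftrightarrow> (\<exists>H. q = from_blocks H \<and> fam H \<and> inside H b \<and> F \<subseteq> H
        \<and> (\<forall>B\<in>b. card {C \<in> H. C \<subseteq> B} = m B))"
    obtain H where "fam H \<and> inside H b \<and> F \<subseteq> H \<and> (\<forall>B\<in>b. card {C \<in> H. C \<subseteq> B} = m B)"
      using block_family_extend[OF _ b k0 F m] by auto
    then show ?thesis using iff[of "from_blocks H"] by blast
  qed
next
  fix \<sigma> q r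
  assume \<sigma>: "\<sigma> \<in> OC" and q: "q \<in> T (\<sigma> - K)" "insert q \<sigma> \<in> OC" and r: "r \<in> T (\<sigma> - K)" "insert r \<sigma> \<in> OC"
  show "\<exists>g\<in>carrier (sym_group n). (\<forall>x\<in>\<sigma>. permute_partition g x = x) \<and> permute_partition g q = r"
  proof (rule cone_structure[OF \<sigma>])
    fix b m F
    assume b: "partition_on A b"
      and iff: "\<And>q. q \<in> T (\<sigma> - K) \<and> insert q \<sigma> \<in> OC \<longleftrightarrow> (\<exists>H. q = from_blocks H \<and> fam H \<and> inside H b \<and> F \<subseteq> H
        \<and> (\<forall>B\<in>b. card {C \<in> H. C \<subseteq> B} = m B))"
      and chain: "\<And>x. x \<in> \<sigma> \<Longrightarrow> leq b x \<or> x \<in> K \<and> kblocks x \<subseteq> F"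
    obtain H1 where H1: "q = from_blocks H1" "fam H1" "inside H1 b" "F \<subseteq> H1"
      "\<forall>B\<in>b. card {C \<in> H1. C \<subseteq> B} = m B" using iff[of q] q by blast
    obtain H2 where H2: "r = from_blocks H2" "fam H2" "inside H2 b" "F \<subseteq> H2"
      "\<forall>B\<in>b. card {C \<in> H2. C \<subseteq> B} = m B" using iff[of r] r by blast
    obtain g where g: "g permutes A" "\<forall>B\<in>b. g ` B = B" "\<forall>C\<in>F. g ` C = C" "(`) g ` H1 = H2"
      using block_family_transitive[OF finite_atLeastAtMost b k0 H1(2,3) H2(2,3) H1(4) H2(4)] H1(5) H2(5)
      by auto
    have "permute_partition g x = x" if x: "x \<in> \<sigma>" for x
    proof (cases "leq b x")
      case True
      then show ?thesis using permute_partition_coarser[OF g(1)] g(2) by blast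
    next
      case False
      then have "x \<in> K" "kblocks x \<subseteq> F" using chain[OF x] by auto
      moreover from this have "(`) g ` kblocks x = id ` kblocks x"
        using g(3) by (intro image_cong) auto
      ultimately show ?thesis
        using permute_partition_from_blocks[OF g(1), of "kblocks x"] K_eq by simp
    qed
    moreover have "permute_partition g q = r"
      using permute_partition_from_blocks[OF g(1)] g(4) H1(1) H2(1) by simp
    moreover have "g \<in> carrier (sym_group n)" using g(1) by (simp add: sym_group_carrier)
    ultimately show ?thesis by blast
  qed
qed

end

theorem corollary3p4p5:
  fixes n k :: nat and \<Lambda> :: "nat multiset set" and i :: int
  assumes "2 \<le> k" and "k < n"
    and "\<Lambda> \<subseteq> number_partitions n" and "\<Lambda> \<noteq> {}"
    and "replicate_mset n 1 \<notin> \<Lambda>" and "{#n#} \<notin> \<Lambda>"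
    and "\<And>\<mu>. \<mu> \<in> \<Lambda> \<Longrightarrow>
           replicate_mset (\<Sum>x\<in>#\<mu>. x div k) k + replicate_mset (\<Sum>x\<in>#\<mu>. x mod k) 1 \<in> \<Lambda>"
    and "CHAR('a::field) = 0 \<or> CHAR('a) > n"
  shows "trivial_multiplicity (sym_group n) (ring_of_type_algebra :: 'a ring)
           (reduced_homology (Pi_poset n \<Lambda>) (refines {1..n}) i)
           homology_action = 0"
proof -
  interpret closed_partition_types n k \<Lambda>
    using assms by unfold_locales
  \<comment> \<open>The characteristic is 0 or a prime larger than \<open>n\<close>, and neither
    divides n!.\<close>
  have "\<not> CHAR('a) dvd fact n"
  proof (cases "CHAR('a) = 0")
    case False
    then have "prime CHAR('a)" by (simp add: prime_CHAR_semidom)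
    then show ?thesis using False assms(8) by (simp add: prime_dvd_fact_iff)
  qed simp
  then have "of_nat (fact n) \<noteq> (0::'a)" by (simp only: of_nat_eq_0_iff_char_dvd not_False_eq_True)
  moreover have "card (carrier (sym_group n)) = fact n"
    by (simp add: sym_group_def card_permutations)
  ultimately have char: "of_nat (card (carrier (sym_group n))) \<noteq> (0::'a)" by simp
  \<comment> \<open>From 2 \<le> k < n; this rules out characteristic 2, as \<open>del_del\<close>
    requires.\<close>
  have "(2::nat) dvd fact n" using assms(1,2) by (simp add: dvd_fact)
  then have "of_nat 2 \<noteq> (0::'a)"
    using \<open>of_nat (fact n) \<noteq> (0::'a)\<close> by (metis dvd_def mult_zero_left of_nat_mult)
  then have two: "(2::'a) \<noteq> 0" by simp
  have "homology_action = (\<lambda>g A. chain_map (permute_partition g) ` (A :: (nat set set set \<Rightarrow> 'a) set))"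
    by (simp add: fun_eq_iff homology_action_def)
  then show ?thesis
    using trivial_multiplicity_homology_eq_0[OF char two invariant_cycle_is_boundary[OF _ _ char two]]
    by simp
qed

end
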